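(* Let $\mathrm{pen}:\mathcal{M}\to\mathbb{R}^+$ be a penalty of the form $\mathrm{pen}(m)=c_0D_m$, where, for $m\in\mathcal{M}$, $D_m$ is the dimension of $S_m$. If $c_0$ is positive and large enough (larger than a suitable absolute constant) and if $\|s\|_\infty<1$, then $$\mathbb{E}_s\big[\|s-\tilde{s}\|^2\big]\leq C(c_0)\,(1-\|s\|_\infty)^{-1}\inf_{m\in\mathcal{M}}\mathbb{E}_s\big[\|s-\hat{s}_m\|^2\big],$$ where $C(c_0)>0$ depends only on $c_0$.
   Context: Let $r\geq 2$ be an integer and $n=2^N$ a power of $2$. $\mathscr{M}(r,n)$ is the space of real $r\times n$ matrices with norm $\|t\|=\big(\sum_{i=1}^n\sum_{l=1}^r(t_i^{(l)})^2\big)^{1/2}$ and $\|t\|_\infty=\max_{i,l}|t_i^{(l)}|$, where $t_i^{(l)}$ is the entry in row $l$, column $i$. Statistical framework. $Y_1,\ldots,Y_n$ are independent random variables with values in $\{1,\ldots,r\}$; their distribution is encoded by the matrix $s\in\mathscr{M}(r,n)$ whose $i$-th column is $s_i=(\mathbb{P}(Y_i=1),\ldots,\mathbb{P}(Y_i=r))^T$. $X$ is the random $r\times n$ matrix with $i$-th column $X_i=(1_{Y_i=1},\ldots,1_{Y_i=r})^T$. $\mathbb{E}_s$ is expectation when the distribution is $s$. Dyadic partitions and preliminary estimator. The dyadic intervals of $\{1,\ldots,n\}$ are the sets $\{k2^{N-j}+1,\ldots,(k+1)2^{N-j}\}$, $0\leq j\leq N$, $0\leq k\leq 2^j-1$.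 $\mathcal{M}$ is the collection of all partitions of $\{1,\ldots,n\}$ into dyadic intervals. For $m\in\mathcal{M}$, $S_m\subset\mathbb{R}^n$ is the linear span of the indicator vectors of the intervals $I\in m$, and $\mathbb{R}^r\otimes S_m$ is the subspace of $\mathscr{M}(r,n)$ of matrices whose rows all belong to $S_m$. Let $\hat{s}_m=\operatorname{argmin}_{t\in\mathbb{R}^r\otimes S_m}\|X-t\|^2$, let $\hat{m}$ be a minimizer over $m\in\mathcal{M}$ of $\|X-\hat{s}_m\|^2+\mathrm{pen}(m)$, and define the preliminary estimator $\tilde{s}=\hat{s}_{\hat{m}}$. *)

theory Defs
  imports "HOL-Probability.Probability" "HOL-Library.Function_Algebras"
begin

instantiation "fun" :: (type, real_vector) real_vector
begin

definition scaleR_fun :: "real \<Rightarrow> ('a \<Rightarrow> 'b) \<Rightarrow> 'a \<Rightarrow> 'b" where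
  "scaleR_fun c f = (\<lambda>x. c *\<^sub>R f x)"

instance
  by standard (auto simp: scaleR_fun_def plus_fun_def fun_eq_iff scaleR_add_right scaleR_add_left)

end


text \<open>
  Since \<open>r\<close> and \<open>n\<close> vary inside the theorem, a real \<open>r \<times> n\<close> matrix is a function
  \<open>t\<close> with \<open>t l i\<close> the entry in row \<open>l\<close> and column \<open>i\<close> (counted from 1) and zero outside
  the index range. Vectors of dimension \<open>n\<close> are likewise functions on \<open>nat\<close> vanishing
  outside \<open>{1..n}\<close>.
\<close>

type_synonym rmat = "nat \<Rightarrow> nat \<Rightarrow> real"

definition mat_space :: "nat \<Rightarrow> nat \<Rightarrow> rmat set" where
  "mat_space r n = {t. \<forall>l i. l \<notin> {1..r} \<or> i \<notin> {1..n} \<longrightarrow> t l i = 0}"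

definition frob_norm :: "nat \<Rightarrow> nat \<Rightarrow> rmat \<Rightarrow> real" where
  "frob_norm r n t = sqrt (\<Sum>i=1..n. \<Sum>l=1..r. (t l i)\<^sup>2)"

definition max_norm :: "nat \<Rightarrow> nat \<Rightarrow> rmat \<Rightarrow> real" where
  "max_norm r n t = Max {\<bar>t l i\<bar> | l i. l \<in> {1..r} \<and> i \<in> {1..n}}"

definition distribution_matrices :: "nat \<Rightarrow> nat \<Rightarrow> rmat set" where
  "distribution_matrices r n =
     {s \<in> mat_space r n. (\<forall>l i. 0 \<le> s l i) \<and> (\<forall>i\<in>{1..n}. (\<Sum>l=1..r. s l i) = 1)}"

text \<open>
  \<open>law n s\<close> is the joint law of \<open>(Y\<^sub>1, \<dots>, Y\<^sub>n)\<close> for independent \<open>Y\<^sub>i\<close> with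
  \<open>P(Y\<^sub>i = l) = s l i\<close>; an outcome is a function \<open>y\<close> with \<open>y i\<close> the value of \<open>Y\<^sub>i\<close> and
  the dummy value 0 outside \<open>{1..n}\<close>. Lemma \<open>expectation_eq_expect\<close> below shows that
  \<open>expect n s f\<close> is the expectation of \<open>f (Y\<^sub>1, \<dots>, Y\<^sub>n)\<close> on an arbitrary probability space.
\<close>

definition law :: "nat \<Rightarrow> rmat \<Rightarrow> (nat \<Rightarrow> nat) pmf" where
  "law n s = Pi_pmf {1..n} 0 (\<lambda>i. embed_pmf (\<lambda>l. s l i))"

definition expect :: "nat \<Rightarrow> rmat \<Rightarrow> ((nat \<Rightarrow> nat) \<Rightarrow> real) \<Rightarrow> real" where
  "expect n s f = measure_pmf.expectation (law n s) f"

definition outcomes :: "nat \<Rightarrow> nat \<Rightarrow> (nat \<Rightarrow> nat) set" where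
  "outcomes r n = PiE_dflt {1..n} 0 (\<lambda>_. {1..r})"

definition obs_matrix :: "nat \<Rightarrow> nat \<Rightarrow> (nat \<Rightarrow> nat) \<Rightarrow> rmat" where
  "obs_matrix r n y = (\<lambda>l i. if l \<in> {1..r} \<and> i \<in> {1..n} \<and> y i = l then 1 else 0)"

definition dyadic_intervals :: "nat \<Rightarrow> nat set set" where
  "dyadic_intervals N = {{k * 2 ^ (N - j) + 1..(k + 1) * 2 ^ (N - j)} | j k. j \<le> N \<and> k \<le> 2 ^ j - 1}"

definition dyadic_partitions :: "nat \<Rightarrow> nat set set set" where
  "dyadic_partitions N = {m. partition_on {1..2 ^ N} m \<and> m \<subseteq> dyadic_intervals N}"

definition model_space :: "nat set set \<Rightarrow> (nat \<Rightarrow> real) set" where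
  "model_space m = span (indicator ` m)"

definition model_dim :: "nat set set \<Rightarrow> nat" where
  "model_dim m = dim (model_space m)"

definition tensor_S :: "nat \<Rightarrow> nat \<Rightarrow> nat set set \<Rightarrow> rmat set" where
  "tensor_S r n m = {t \<in> mat_space r n. \<forall>l\<in>{1..r}. t l \<in> model_space m}"

definition least_squares :: "nat \<Rightarrow> nat \<Rightarrow> nat set set \<Rightarrow> rmat \<Rightarrow> rmat" where
  "least_squares r n m X = arg_min_on (\<lambda>t. (frob_norm r n (X - t))\<^sup>2) (tensor_S r n m)"

abbreviation s_hat :: "nat \<Rightarrow> nat \<Rightarrow> nat set set \<Rightarrow> (nat \<Rightarrow> nat) \<Rightarrow> rmat" where
  "s_hat r n m y \<equiv> least_squares r n m (obs_matrix r n y)"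

text \<open>
  The minimizer of the penalized criterion need not be unique, so a selection rule is any
  function of the data that picks a minimizer for every possible outcome.
\<close>

definition selects_minimizer ::
  "nat \<Rightarrow> nat \<Rightarrow> (nat set set \<Rightarrow> real) \<Rightarrow> ((nat \<Rightarrow> nat) \<Rightarrow> nat set set) \<Rightarrow> bool" where
  "selects_minimizer r N pen m_hat \<longleftrightarrow>
     (\<forall>y\<in>outcomes r (2 ^ N).
        is_arg_min (\<lambda>m. (frob_norm r (2 ^ N) (obs_matrix r (2 ^ N) y - s_hat r (2 ^ N) m y))\<^sup>2 + pen m)
          (\<lambda>m. m \<in> dyadic_partitions N) (m_hat y))"

definition s_tilde ::
  "nat \<Rightarrow> nat \<Rightarrow> ((nat \<Rightarrow> nat) \<Rightarrow> nat set set) \<Rightarrow> (nat \<Rightarrow> nat) \<Rightarrow> rmat" where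
  "s_tilde r n m_hat y = s_hat r n (m_hat y) y"


lemma pmf_embed_column:
  assumes s: "s \<in> distribution_matrices r n" and i: "i \<in> {1..n}"
  shows "pmf (embed_pmf (\<lambda>l. s l i)) l = s l i"
proof (rule pmf_embed_pmf)
  show "0 \<le> s l i" for l
    using s by (simp add: distribution_matrices_def)
  have z: "s l i = 0" if "l \<notin> {1..r}" for l
    using s that by (auto simp: distribution_matrices_def mat_space_def)
  have "(\<integral>\<^sup>+ l. ennreal (s l i) \<partial>count_space UNIV) = (\<integral>\<^sup>+ l. ennreal (s l i) \<partial>count_space {1..r})"
    by (rule nn_integral_count_space_eq) (use z in auto)
  also have "\<dots> = (\<Sum>l=1..r. ennreal (s l i))"
    by (simp add: nn_integral_count_space_finite)
  also have "\<dots> = ennreal (\<Sum>l=1..r. s l i)"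
    using s by (intro sum_ennreal) (auto simp: distribution_matrices_def)
  also have "\<dots> = 1"
    using s i by (simp add: distribution_matrices_def)
  finally show "(\<integral>\<^sup>+ l. ennreal (s l i) \<partial>count_space UNIV) = 1" .
qed

lemma expectation_eq_expect:
  fixes M :: "'a measure" and Y :: "nat \<Rightarrow> 'a \<Rightarrow> nat" and f :: "(nat \<Rightarrow> nat) \<Rightarrow> real"
  assumes M: "prob_space M" and n: "n \<ge> 1"
    and indep: "prob_space.indep_vars M (\<lambda>_. count_space {1..r}) Y {1..n}"
    and s: "s \<in> mat_space r n"
    and prob: "\<And>l i. l \<in> {1..r} \<Longrightarrow> i \<in> {1..n} \<Longrightarrow> s l i = measure M {\<omega> \<in> space M. Y i \<omega> = l}"
  shows "s \<in> distribution_matrices r n"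
    and "(\<integral>\<omega>. f (\<lambda>i. if i \<in> {1..n} then Y i \<omega> else 0) \<partial>M) = expect n s f"
proof -
  interpret prob_space M by (rule M)
  have rv: "Y i \<in> measurable M (count_space {1..r})" if "i \<in> {1..n}" for i
    using indep that by (auto simp: indep_vars_def)
  have ran: "Y i \<omega> \<in> {1..r}" if "i \<in> {1..n}" "\<omega> \<in> space M" for i \<omega>
    using measurable_space[OF rv[OF that(1)] that(2)] by simp
  have ev: "{\<omega> \<in> space M. Y i \<omega> = l} \<in> events" if "i \<in> {1..n}" for i l
  proof (cases "l \<in> {1..r}")
    case True
    then have "Y i -` {l} \<inter> space M \<in> events"
      by (intro measurable_sets[OF rv[OF that]]) auto
    moreover have "Y i -` {l} \<inter> space M = {\<omega> \<in> space M. Y i \<omega> = l}" by auto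
    ultimately show ?thesis by simp
  next
    case False
    then have "{\<omega> \<in> space M. Y i \<omega> = l} = {}" using ran[OF that] by auto
    then show ?thesis by (simp only: sets.empty_sets)
  qed
  show sd: "s \<in> distribution_matrices r n"
    unfolding distribution_matrices_def
  proof (intro CollectI conjI allI ballI s)
    show "0 \<le> s l i" for l i
    proof (cases "l \<in> {1..r} \<and> i \<in> {1..n}")
      case True
      then show ?thesis using prob by simp
    next
      case False
      then have "s l i = 0" using s unfolding mat_space_def by blast
      then show ?thesis by simp
    qed
    fix i assume i: "i \<in> {1..n}"
    have "(\<Sum>l=1..r. s l i) = (\<Sum>l=1..r. prob {\<omega> \<in> space M. Y i \<omega> = l})"
      using i prob by (intro sum.cong) auto
    also have "\<dots> = prob (\<Union>l\<in>{1..r}. {\<omega> \<in> space M. Y i \<omega> = l})"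
      by (rule finite_measure_finite_Union[symmetric])
         (use ev[OF i] in \<open>auto simp: disjoint_family_on_def\<close>)
    also have "(\<Union>l\<in>{1..r}. {\<omega> \<in> space M. Y i \<omega> = l}) = space M"
      using ran[OF i] by auto
    finally show "(\<Sum>l=1..r. s l i) = 1" by (simp add: prob_space)
  qed
  define g where "g = (\<lambda>\<omega> i. if i \<in> {1..n} then Y i \<omega> else 0)"
  define F where "F = outcomes r n"
  have finF: "finite F" unfolding F_def outcomes_def by (intro finite_PiE_dflt) auto
  have gF: "g \<omega> \<in> F" if "\<omega> \<in> space M" for \<omega>
    using ran that by (auto simp: g_def F_def outcomes_def PiE_dflt_def)
  have gset: "{\<omega> \<in> space M. g \<omega> = h} = (\<Inter>i\<in>{1..n}. {\<omega> \<in> space M. Y i \<omega> = h i})" if "h \<in> F" for h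
    using that n by (auto simp: g_def F_def outcomes_def PiE_dflt_def fun_eq_iff)
  have gev: "{\<omega> \<in> space M. g \<omega> = h} \<in> events" if "h \<in> F" for h
    unfolding gset[OF that] using n ev by (intro sets.finite_INT) auto
  have gprob: "prob {\<omega> \<in> space M. g \<omega> = h} = pmf (law n s) h" if h: "h \<in> F" for h
  proof -
    have hr: "h i \<in> {1..r}" if "i \<in> {1..n}" for i
      using h that unfolding F_def outcomes_def PiE_dflt_def by blast
    have h0: "h i = 0" if "i \<notin> {1..n}" for i
      using h that unfolding F_def outcomes_def PiE_dflt_def by blast
    have eq: "Y i -` {h i} \<inter> space M = {\<omega> \<in> space M. Y i \<omega> = h i}" for i by auto
    have "prob (\<Inter>i\<in>{1..n}. Y i -` {h i} \<inter> space M) = (\<Prod>i\<in>{1..n}. prob (Y i -` {h i} \<inter> space M))"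
      by (rule indep_varsD_finite[OF indep]) (use n hr in auto)
    also have "\<dots> = (\<Prod>i\<in>{1..n}. s (h i) i)"
      by (intro prod.cong refl) (use hr prob in \<open>simp add: eq\<close>)
    also have "\<dots> = (\<Prod>i\<in>{1..n}. pmf (embed_pmf (\<lambda>l. s l i)) (h i))"
      by (intro prod.cong refl) (simp add: pmf_embed_column[OF sd])
    also have "\<dots> = pmf (law n s) h"
      unfolding law_def by (rule pmf_Pi'[symmetric]) (use h0 in auto)
    finally show ?thesis unfolding gset[OF h] eq .
  qed
  have sub: "set_pmf (law n s) \<subseteq> F"
  proof
    fix h assume h: "h \<in> set_pmf (law n s)"
    then have "h \<in> PiE_dflt {1..n} 0 (set_pmf \<circ> (\<lambda>i. embed_pmf (\<lambda>l. s l i)))"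
      unfolding law_def by (simp add: set_Pi_pmf)
    then have hi: "\<forall>i. (i \<in> {1..n} \<longrightarrow> h i \<in> set_pmf (embed_pmf (\<lambda>l. s l i))) \<and> (i \<notin> {1..n} \<longrightarrow> h i = 0)"
      unfolding PiE_dflt_def by simp
    have "h i \<in> {1..r}" if "i \<in> {1..n}" for i
    proof (rule ccontr)
      assume "h i \<notin> {1..r}"
      then have "s (h i) i = 0" using s unfolding mat_space_def by blast
      then show False
        using hi that pmf_embed_column[OF sd that, of "h i"] by (metis set_pmf_iff)
    qed
    with hi show "h \<in> F" unfolding F_def outcomes_def PiE_dflt_def by blast
  qed
  have "(\<integral>\<omega>. f (g \<omega>) \<partial>M) = (\<integral>\<omega>. (\<Sum>h\<in>F. f h * indicator {\<omega> \<in> space M. g \<omega> = h} \<omega>) \<partial>M)"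
  proof (rule Bochner_Integration.integral_cong[OF refl])
    fix \<omega> assume \<omega>: "\<omega> \<in> space M"
    have "(\<Sum>h\<in>F. f h * indicator {\<omega> \<in> space M. g \<omega> = h} \<omega>) = (\<Sum>h\<in>F. if h = g \<omega> then f h else 0)"
      using \<omega> by (intro sum.cong) (auto simp: indicator_def)
    also have "\<dots> = f (g \<omega>)"
      using finF gF[OF \<omega>] by (simp add: sum.delta)
    finally show "f (g \<omega>) = (\<Sum>h\<in>F. f h * indicator {\<omega> \<in> space M. g \<omega> = h} \<omega>)" by simp
  qed
  also have "\<dots> = (\<Sum>h\<in>F. (\<integral>\<omega>. f h * indicator {\<omega> \<in> space M. g \<omega> = h} \<omega> \<partial>M))"
    by (rule Bochner_Integration.integral_sum)
       (use gev in \<open>auto intro!: integrable_real_mult_indicator simp: emeasure_eq_measure\<close>)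
  also have "\<dots> = (\<Sum>h\<in>F. f h * pmf (law n s) h)"
    by (intro sum.cong refl) (use gev gprob in \<open>simp add: Int_def conj_ac cong: conj_cong\<close>)
  also have "\<dots> = expect n s f"
    unfolding expect_def
    by (rule integral_measure_pmf_real[symmetric, OF finF]) (use sub in auto)
  finally show "(\<integral>\<omega>. f (\<lambda>i. if i \<in> {1..n} then Y i \<omega> else 0) \<partial>M) = expect n s f"
    unfolding g_def .
qed

end

theory Submission
  imports Defs
begin

text \<open>
  For \<open>\<epsilon> = X - s\<close> and a block \<open>I\<close> put \<open>Z\<^sub>I = \<parallel>\<Sum>\<^bsub>i\<in>I\<^esub> \<epsilon>\<^sub>i\<parallel>\<^sup>2 / |I|\<close>. Expanding
  \<open>\<parallel>x + \<epsilon>\<^sub>i\<parallel>\<^sup>2\<close> and applying Hoeffding's lemma to the linear term, one summand at a time, gives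
  \<open>E exp (Z\<^sub>I / 8) \<le> exp (1/2)\<close>, with no dependence on \<open>r\<close>. Define \<open>V\<close> recursively on the dyadic
  tree by \<open>V(I) = exp ((Z\<^sub>I - 16) / 8) + V(left half) V(right half)\<close>. It dominates
  \<open>\<Prod>\<^bsub>I\<in>m\<^esub> exp ((Z\<^sub>I - 16) / 8)\<close> for every dyadic partition \<open>m\<close>, and independence of the two halves
  yields \<open>E V \<le> 1/2\<close>. Hence \<open>\<Sum>\<^bsub>I\<in>m\<^esub> Z\<^sub>I \<le> 16 D\<^sub>m + 8 V\<close> simultaneously for all \<open>m\<close>, without
  counting partitions.

  The difference of the preliminary estimator and the least squares estimator \<open>s\<^sub>m\<close> of a
  competitor \<open>m\<close> is constant on the blocks of the common refinement of the two partitions, which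
  is dyadic of dimension at most the sum of the two dimensions. The definition of the selected
  partition and \<open>2 a b \<le> 4 a\<^sup>2 + b\<^sup>2 / 4\<close> on each block therefore bound the risk by
  \<open>3 E\<parallel>s - s\<^sub>m\<parallel>\<^sup>2 + 2 (c\<^sub>0 + 64) D\<^sub>m + 32\<close> once \<open>c\<^sub>0 \<ge> 64\<close>. Finally
  \<open>\<parallel>s - s\<^sub>m\<parallel>\<^sup>2 \<ge> \<Sum>\<^bsub>I\<in>m\<^esub> Z\<^sub>I\<close>, whose mean is at least \<open>(1 - \<parallel>s\<parallel>\<^sub>\<infinity>) D\<^sub>m\<close>, so the remainder
  terms are absorbed.
\<close>

subsection \<open>Exponential moments of block statistics\<close>

lemma finite_set_Pi_pmf:
  assumes "finite A" "\<And>i. i \<in> A \<Longrightarrow> finite (set_pmf (p i))"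
  shows "finite (set_pmf (Pi_pmf A d p))"
  using assms by (auto simp: set_Pi_pmf intro!: finite_PiE_dflt)

lemma expectation_pair_pmf_finite:
  fixes f :: "'a \<times> 'b \<Rightarrow> real"
  assumes p: "finite (set_pmf p)" and q: "finite (set_pmf q)"
  shows "measure_pmf.expectation (pair_pmf p q) f =
    measure_pmf.expectation p (\<lambda>a. measure_pmf.expectation q (\<lambda>b. f (a, b)))"
proof -
  have "measure_pmf.expectation (pair_pmf p q) f =
      (\<Sum>(a, b)\<in>set_pmf p \<times> set_pmf q. f (a, b) * (pmf p a * pmf q b))"
    by (subst integral_measure_pmf_real[of "set_pmf p \<times> set_pmf q"])
       (use p q in \<open>auto simp: pmf_pair intro!: sum.cong\<close>)
  also have "\<dots> = (\<Sum>a\<in>set_pmf p. (\<Sum>b\<in>set_pmf q. f (a, b) * pmf q b) * pmf p a)"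
    by (simp add: sum.cartesian_product[symmetric] sum_distrib_left sum_distrib_right mult_ac)
  also have "\<dots> = measure_pmf.expectation p (\<lambda>a. measure_pmf.expectation q (\<lambda>b. f (a, b)))"
    by (simp add: integral_measure_pmf_real[OF p] integral_measure_pmf_real[OF q])
  finally show ?thesis .
qed

lemma expectation_Pi_pmf_insert:
  fixes f :: "('a \<Rightarrow> 'b) \<Rightarrow> real"
  assumes A: "finite A" "x \<notin> A" and fin: "\<And>i. i \<in> insert x A \<Longrightarrow> finite (set_pmf (p i))"
  shows "measure_pmf.expectation (Pi_pmf (insert x A) d p) f =
    measure_pmf.expectation (p x) (\<lambda>v. measure_pmf.expectation (Pi_pmf A d p) (\<lambda>g. f (g(x := v))))"
  using A fin
  by (simp add: Pi_pmf_insert expectation_pair_pmf_finite finite_set_Pi_pmf case_prod_unfold)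

text \<open>This plays the part of measurability with respect to the coordinates in
  \<open>A\<close>: outcomes that agree on \<open>A\<close> are not distinguished.\<close>

definition depends_on :: "(('a \<Rightarrow> 'b) \<Rightarrow> 'c) \<Rightarrow> 'a set \<Rightarrow> bool" where
  "depends_on f A \<longleftrightarrow> (\<forall>y y'. (\<forall>i\<in>A. y i = y' i) \<longrightarrow> f y = f y')"

lemma depends_onD: "depends_on f A \<Longrightarrow> (\<And>i. i \<in> A \<Longrightarrow> y i = y' i) \<Longrightarrow> f y = f y'"
  unfolding depends_on_def by blast

text \<open>\<open>Pi_pmf_subset\<close> presents the product over \<open>A\<close> as the image of
  the product over \<open>S\<close> under resetting the coordinates outside \<open>A\<close> to
  \<open>d\<close>, and \<open>f\<close> does not see this resetting.\<close>

lemma expectation_Pi_pmf_restrict: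
  fixes f :: "('a \<Rightarrow> 'b) \<Rightarrow> real"
  assumes "finite S" "A \<subseteq> S" "depends_on f A"
  shows "measure_pmf.expectation (Pi_pmf S d p) f = measure_pmf.expectation (Pi_pmf A d p) f"
proof -
  have "f (\<lambda>x. if x \<in> A then y x else d) = f y" for y
    by (rule depends_onD[OF assms(3)]) simp
  then show ?thesis
    by (subst Pi_pmf_subset[OF assms(1,2)]) simp
qed

text \<open>Independence of functions of disjoint sets of coordinates: the product law on
  \<open>A \<union> B\<close> is the law of two independent draws glued together, so the double
  expectation factorises.\<close>

lemma expectation_Pi_pmf_mult:
  fixes f g :: "('a \<Rightarrow> 'b) \<Rightarrow> real"
  assumes S: "finite S" "A \<subseteq> S" "B \<subseteq> S" and disj: "A \<inter> B = {}"
    and fin: "\<And>i. i \<in> S \<Longrightarrow> finite (set_pmf (p i))"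
    and f: "depends_on f A" and g: "depends_on g B"
  shows "measure_pmf.expectation (Pi_pmf S d p) (\<lambda>y. f y * g y) =
    measure_pmf.expectation (Pi_pmf S d p) f * measure_pmf.expectation (Pi_pmf S d p) g"
proof -
  have AB: "finite A" "finite B" using S by (auto intro: finite_subset)
  have fg: "depends_on (\<lambda>y. f y * g y) (A \<union> B)"
    using f g unfolding depends_on_def by (metis Un_iff)
  have 1: "f (\<lambda>x. if x \<in> A then a x else b x) = f a" for a b
    by (rule depends_onD[OF f]) simp
  have 2: "g (\<lambda>x. if x \<in> A then a x else b x) = g b" for a b
    by (rule depends_onD[OF g]) (use disj in auto)
  have "measure_pmf.expectation (Pi_pmf S d p) (\<lambda>y. f y * g y) =
      measure_pmf.expectation (Pi_pmf (A \<union> B) d p) (\<lambda>y. f y * g y)"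
    using S fg by (intro expectation_Pi_pmf_restrict) auto
  also have "\<dots> = measure_pmf.expectation (Pi_pmf A d p) f * measure_pmf.expectation (Pi_pmf B d p) g"
    using S fin
    by (simp add: Pi_pmf_union[OF AB disj] case_prod_unfold 1 2, subst expectation_pair_pmf_finite)
       (auto intro!: finite_set_Pi_pmf AB)
  finally show ?thesis
    using expectation_Pi_pmf_restrict[OF S(1,2) f] expectation_Pi_pmf_restrict[OF S(1,3) g] by metis
qed

lemma expectation_mono_finite:
  fixes f g :: "'a \<Rightarrow> real"
  assumes "finite (set_pmf p)" "\<And>y. y \<in> set_pmf p \<Longrightarrow> f y \<le> g y"
  shows "measure_pmf.expectation p f \<le> measure_pmf.expectation p g"
  using assms by (intro integral_mono_AE) (auto simp: integrable_measure_pmf_finite AE_measure_pmf_iff)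

section \<open>Exponential moments of squared noise sums\<close>

definition noise :: "('a \<Rightarrow> 'b pmf) \<Rightarrow> ('a \<Rightarrow> 'b) \<Rightarrow> 'b \<Rightarrow> 'a \<Rightarrow> real" where
  "noise p y l i = of_bool (y i = l) - pmf (p i) l"

text \<open>Expanding the square leaves the squared norm \<open>Q\<close> of \<open>x\<close>, a
  centred linear term and a remainder of at most 2. The linear term is handled by Hoeffding's lemma,
  since \<open>x k\<close> stays between \<open>- sqrt Q\<close> and \<open>sqrt Q\<close>. The
  number of categories never enters.\<close>

lemma exp_moment_one_category:
  fixes x :: "'b \<Rightarrow> real"
  assumes L: "finite L" "set_pmf p \<subseteq> L" and b: "b > 0"
  shows "measure_pmf.expectation p (\<lambda>k. exp (b * (\<Sum>l\<in>L. (x l + (of_bool (k = l) - pmf p l))\<^sup>2)))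
    \<le> exp (b * (1 + 4 * b) * (\<Sum>l\<in>L. (x l)\<^sup>2) + 2 * b)"
proof -
  have fin: "finite (set_pmf p)" using L finite_subset by blast
  define \<mu> where "\<mu> = measure_pmf.expectation p x"
  define Q where "Q = (\<Sum>l\<in>L. (x l)\<^sup>2)"
  have Q0: "Q \<ge> 0" unfolding Q_def by (intro sum_nonneg) auto
  have \<mu>: "\<mu> = (\<Sum>l\<in>L. x l * pmf p l)"
    unfolding \<mu>_def using L by (intro integral_measure_pmf_real) auto
  have xM: "\<bar>x k\<bar> \<le> sqrt Q" if "k \<in> L" for k
    using member_le_sum[of k L "\<lambda>l. (x l)\<^sup>2"] that L unfolding Q_def
    by (metis real_sqrt_abs real_sqrt_le_iff zero_le_power2)
  have sum1: "(\<Sum>l\<in>L. pmf p l) = 1" using L by (simp add: sum_pmf_eq_1)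
  have bound: "(\<Sum>l\<in>L. (x l + (of_bool (k = l) - pmf p l))\<^sup>2) \<le> Q + 2 * (x k - \<mu>) + 2"
    if k: "k \<in> L" for k
  proof -
    have e1: "(\<Sum>l\<in>L. (x l + (of_bool (k = l) - pmf p l))\<^sup>2) =
        Q + 2 * (\<Sum>l\<in>L. x l * (of_bool (k = l) - pmf p l)) + (\<Sum>l\<in>L. (of_bool (k = l) - pmf p l)\<^sup>2)"
      unfolding Q_def by (simp add: power2_sum sum.distrib sum_distrib_left mult.assoc)
    have e2: "(\<Sum>l\<in>L. x l * (of_bool (k = l) - pmf p l)) = x k - \<mu>"
      using L k by (simp add: \<mu> right_diff_distrib sum_subtractf)
    \<comment> \<open>The cross term of the square is nonpositive, and a number in the unit interval
      dominates its square.\<close>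
    have "(of_bool (k = l) - pmf p l)\<^sup>2 \<le> of_bool (k = l) + pmf p l" for l
    proof -
      have "(pmf p l)\<^sup>2 \<le> pmf p l" by (simp add: power2_eq_square mult_left_le pmf_le_1)
      then show ?thesis by (auto simp: power2_diff pmf_nonneg intro: order_trans[of _ "pmf p l"])
    qed
    then have e3: "(\<Sum>l\<in>L. (of_bool (k = l) - pmf p l)\<^sup>2) \<le> (\<Sum>l\<in>L. of_bool (k = l) + pmf p l)"
      by (intro sum_mono)
    have e4: "(\<Sum>l\<in>L. of_bool (k = l) + pmf p l) = 2"
      using L k by (simp add: sum.distrib sum1)
    show ?thesis
      unfolding e1 e2 using e3 unfolding e4 by (rule add_left_mono)
  qed
  interpret interval_bounded_random_variable "measure_pmf p" x "- sqrt Q" "sqrt Q"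
    by unfold_locales (use xM L in \<open>force simp: AE_measure_pmf_iff abs_le_iff\<close>)+
  \<comment> \<open>The passage through \<open>ennreal\<close> matches the form of
    \<open>Hoeffdings_lemma_nn_integral\<close>, applied with parameter \<open>2 * b\<close> on an
    interval of length \<open>2 * sqrt Q\<close>.\<close>
  have "ennreal (measure_pmf.expectation p (\<lambda>k. exp ((2 * b) * (x k - \<mu>)))) =
      (\<integral>\<^sup>+ k. ennreal (exp ((2 * b) * (x k - \<mu>))) \<partial>measure_pmf p)"
    by (intro nn_integral_eq_integral[symmetric] integrable_measure_pmf_finite fin) auto
  also have "\<dots> \<le> ennreal (exp ((2 * b)\<^sup>2 * (sqrt Q - - sqrt Q)\<^sup>2 / 8))"
    unfolding \<mu>_def by (rule Hoeffdings_lemma_nn_integral) (use b in auto)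
  also have "(2 * b)\<^sup>2 * (sqrt Q - - sqrt Q)\<^sup>2 / 8 = 2 * b\<^sup>2 * Q"
    using Q0 by (simp add: power2_eq_square algebra_simps)
  finally have H: "measure_pmf.expectation p (\<lambda>k. exp ((2 * b) * (x k - \<mu>))) \<le> exp (2 * b\<^sup>2 * Q)"
    by simp
  have "measure_pmf.expectation p (\<lambda>k. exp (b * (\<Sum>l\<in>L. (x l + (of_bool (k = l) - pmf p l))\<^sup>2)))
      \<le> measure_pmf.expectation p (\<lambda>k. exp (b * Q + 2 * b) * exp ((2 * b) * (x k - \<mu>)))"
  proof (rule expectation_mono_finite[OF fin])
    fix k assume "k \<in> set_pmf p"
    then have "b * (\<Sum>l\<in>L. (x l + (of_bool (k = l) - pmf p l))\<^sup>2) \<le> b * (Q + 2 * (x k - \<mu>) + 2)"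
      using bound L b by (intro mult_left_mono) auto
    then show "exp (b * (\<Sum>l\<in>L. (x l + (of_bool (k = l) - pmf p l))\<^sup>2))
        \<le> exp (b * Q + 2 * b) * exp ((2 * b) * (x k - \<mu>))"
      by (simp add: exp_add[symmetric] algebra_simps)
  qed
  also have "\<dots> \<le> exp (b * Q + 2 * b) * exp (2 * b\<^sup>2 * Q)"
    using H by simp
  also have "\<dots> = exp (b * Q + 2 * b + 2 * b\<^sup>2 * Q)" by (simp add: exp_add)
  also have "\<dots> \<le> exp (b * (1 + 4 * b) * Q + 2 * b)"
    using b Q0 by (simp add: power2_eq_square algebra_simps)
  finally show ?thesis unfolding Q_def .
qed

text \<open>Integrating out one summand turns the coefficient \<open>b\<close> of \<open>\<parallel>x\<parallel>\<^sup>2\<close> into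
  \<open>b (1 + 4 b) \<le> b / (1 - 4 b)\<close>, that is, it lowers \<open>1 / b\<close> by at most 4.\<close>

lemma exp_moment_sum:
  fixes x :: "'b \<Rightarrow> real" and p :: "'a \<Rightarrow> 'b pmf"
  assumes A: "finite A" and L: "finite L" "\<And>i. i \<in> A \<Longrightarrow> set_pmf (p i) \<subseteq> L"
    and a: "a > 0" "4 * a * real (card A) < 1"
  shows "measure_pmf.expectation (Pi_pmf A d p)
      (\<lambda>y. exp (a * (\<Sum>l\<in>L. (x l + (\<Sum>i\<in>A. noise p y l i))\<^sup>2)))
    \<le> exp (a / (1 - 4 * a * real (card A)) * ((\<Sum>l\<in>L. (x l)\<^sup>2) + 2 * real (card A)))"
  using A L(2) a(2)
proof (induction A arbitrary: x rule: finite_induct)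
  case empty
  then show ?case by (simp add: Pi_pmf_def)
next
  case (insert j A)
  \<comment> \<open>The coefficients after integrating out \<open>card A\<close> and
    \<open>card A + 1\<close> summands; they satisfy \<open>1 / b' = 1 / b - 4\<close>.\<close>
  define b where "b = a / (1 - 4 * a * real (card A))"
  define b' where "b' = a / (1 - 4 * a * real (card (insert j A)))"
  have cA: "real (card (insert j A)) = card A + 1" using insert.hyps by simp
  have lt: "4 * a * real (card A) + 4 * a < 1" using insert.prems(2) unfolding cA by (simp add: algebra_simps)
  then have lt': "4 * a * real (card A) < 1" using a by linarith
  have b: "b > 0" unfolding b_def using a lt' by simp
  have bb': "b * (1 + 4 * b) \<le> b'" "b \<le> b'"
  proof -
    have b4: "4 * b < 1" unfolding b_def using lt lt' by (simp add: field_simps)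
    define D where "D = 1 - 4 * a * real (card A)"
    have D: "D > 0" unfolding D_def using lt' by simp
    have "b' = a / (D - 4 * a)" "b = a / D"
      unfolding b'_def b_def D_def cA by (simp_all add: algebra_simps)
    moreover from this(2) have "1 - 4 * b = (D - 4 * a) / D" using D by (simp add: field_simps)
    ultimately have "b' = b / (1 - 4 * b)" using D by simp
    moreover have "b * (1 + 4 * b) \<le> b / (1 - 4 * b)"
    proof -
      have "b * ((1 + 4 * b) * (1 - 4 * b)) \<le> b * 1"
        using b by (intro mult_left_mono) (auto simp: algebra_simps)
      then show ?thesis using b4 by (simp add: pos_le_divide_eq mult.assoc)
    qed
    ultimately show "b * (1 + 4 * b) \<le> b'" by simp
    then show "b \<le> b'" using b by (simp add: algebra_simps) (smt (verit) mult_pos_pos)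
  qed
  have finp: "finite (set_pmf (p i))" if "i \<in> insert j A" for i
    using insert.prems(1)[OF that] L(1) finite_subset by blast
  let ?E = "\<lambda>x. measure_pmf.expectation (Pi_pmf A d p)
      (\<lambda>y. exp (a * (\<Sum>l\<in>L. (x l + (\<Sum>i\<in>A. noise p y l i))\<^sup>2)))"
  have eq: "(\<Sum>i\<in>insert j A. noise p (y(j := v)) l i) =
      (of_bool (v = l) - pmf (p j) l) + (\<Sum>i\<in>A. noise p y l i)" for y l v
  proof -
    have "(\<Sum>i\<in>A. noise p (y(j := v)) l i) = (\<Sum>i\<in>A. noise p y l i)"
      using insert.hyps by (intro sum.cong) (auto simp: noise_def)
    then show ?thesis using insert.hyps by (simp add: noise_def)
  qed
  \<comment> \<open>The value drawn at \<open>j\<close> is absorbed into the shift, which is why the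
    induction keeps \<open>x\<close> arbitrary.\<close>
  have "measure_pmf.expectation (Pi_pmf (insert j A) d p)
      (\<lambda>y. exp (a * (\<Sum>l\<in>L. (x l + (\<Sum>i\<in>insert j A. noise p y l i))\<^sup>2))) =
    measure_pmf.expectation (p j) (\<lambda>v. ?E (\<lambda>l. x l + (of_bool (v = l) - pmf (p j) l)))"
    by (subst expectation_Pi_pmf_insert[OF insert.hyps finp]) (simp_all only: eq add.assoc)
  also have "\<dots> \<le> measure_pmf.expectation (p j) (\<lambda>v.
      exp (b * ((\<Sum>l\<in>L. (x l + (of_bool (v = l) - pmf (p j) l))\<^sup>2) + 2 * real (card A))))"
    unfolding b_def using finp insert.prems(1) lt'
    by (intro expectation_mono_finite insert.IH) auto
  also have "\<dots> = measure_pmf.expectation (p j) (\<lambda>v. exp (b * (2 * real (card A))) *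
      exp (b * (\<Sum>l\<in>L. (x l + (of_bool (v = l) - pmf (p j) l))\<^sup>2)))"
    by (simp add: exp_add[symmetric] algebra_simps)
  also have "\<dots> \<le> exp (b * (2 * real (card A))) * exp (b * (1 + 4 * b) * (\<Sum>l\<in>L. (x l)\<^sup>2) + 2 * b)"
    using exp_moment_one_category[OF L(1) _ b, of "p j" x] insert.prems(1) by simp
  also have "\<dots> = exp (b * (1 + 4 * b) * (\<Sum>l\<in>L. (x l)\<^sup>2) + b * (2 * real (card (insert j A))))"
    unfolding cA by (simp add: exp_add[symmetric] algebra_simps)
  also have "\<dots> \<le> exp (b' * (\<Sum>l\<in>L. (x l)\<^sup>2) + b' * (2 * real (card (insert j A))))"
    unfolding exp_le_cancel_iff using bb' by (intro add_mono mult_right_mono) (auto intro: sum_nonneg)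
  finally show ?case unfolding b'_def by (simp add: algebra_simps)
qed

text \<open>This is \<open>Z\<^sub>I\<close> of the overview: the squared norm of the orthogonal
  projection of the noise onto the matrices supported on the columns in \<open>I\<close> with rows
  constant there.\<close>

definition block_stat :: "('a \<Rightarrow> 'b pmf) \<Rightarrow> 'b set \<Rightarrow> 'a set \<Rightarrow> ('a \<Rightarrow> 'b) \<Rightarrow> real" where
  "block_stat p L I y = (\<Sum>l\<in>L. (\<Sum>i\<in>I. noise p y l i)\<^sup>2) / card I"

lemma depends_on_block_stat: "depends_on (block_stat p L I) I"
  unfolding depends_on_def block_stat_def noise_def by auto

text \<open>The case \<open>x = 0\<close> and \<open>a = 1 / (8 * card I)\<close> of
  \<open>exp_moment_sum\<close>. Then \<open>4 * a * card I = 1 / 2\<close>, so the coefficient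
  becomes \<open>2 * a\<close>, and \<open>2 * a * (2 * card I) = 1 / 2\<close>.\<close>

lemma exp_moment_block_stat:
  assumes S: "finite S" "I \<subseteq> S" "I \<noteq> {}" and L: "finite L" "\<And>i. i \<in> S \<Longrightarrow> set_pmf (p i) \<subseteq> L"
  shows "measure_pmf.expectation (Pi_pmf S d p) (\<lambda>y. exp (block_stat p L I y / 8)) \<le> exp (1 / 2)"
proof -
  have I: "finite I" using S finite_subset by blast
  then have c: "real (card I) > 0" using S by (simp add: card_gt_0_iff)
  have "measure_pmf.expectation (Pi_pmf S d p) (\<lambda>y. exp (block_stat p L I y / 8)) =
      measure_pmf.expectation (Pi_pmf I d p) (\<lambda>y. exp (block_stat p L I y / 8))"
    using S depends_on_block_stat[of p L I] unfolding depends_on_def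
    by (intro expectation_Pi_pmf_restrict) (auto simp: depends_on_def)
  also have "\<dots> = measure_pmf.expectation (Pi_pmf I d p)
      (\<lambda>y. exp (1 / (8 * real (card I)) * (\<Sum>l\<in>L. (0 + (\<Sum>i\<in>I. noise p y l i))\<^sup>2)))"
    by (simp add: block_stat_def mult.commute)
  also have "\<dots> \<le> exp (1 / (8 * real (card I)) / (1 - 4 * (1 / (8 * real (card I))) * real (card I)) * ((\<Sum>l\<in>L. 0\<^sup>2) + 2 * real (card I)))"
    using I L S c by (intro exp_moment_sum) auto
  also have "1 / (8 * real (card I)) / (1 - 4 * (1 / (8 * real (card I))) * real (card I)) * ((\<Sum>l\<in>L. 0\<^sup>2) + 2 * real (card I)) = 1 / 2"
    using c by (simp add: field_simps)
  finally show ?thesis .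
qed

text \<open>Variance of a sum of independent centred indicators. The constant \<open>c\<close> is
  arbitrary so that each new summand can be absorbed into it; the cross term vanishes because the
  summand has mean zero.\<close>

lemma expectation_square_noise_sum:
  fixes c :: real
  assumes A: "finite A" and fin: "\<And>i. i \<in> A \<Longrightarrow> finite (set_pmf (p i))"
  shows "measure_pmf.expectation (Pi_pmf A d p) (\<lambda>y. (c + (\<Sum>i\<in>A. noise p y l i))\<^sup>2) =
    c\<^sup>2 + (\<Sum>i\<in>A. pmf (p i) l * (1 - pmf (p i) l))"
  using A fin
proof (induction A arbitrary: c rule: finite_induct)
  case empty
  then show ?case by (simp add: Pi_pmf_def)
next
  case (insert j A)
  define q where "q = pmf (p j) l"
  define W where "W = (\<Sum>i\<in>A. pmf (p i) l * (1 - pmf (p i) l))"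
  have eq: "(\<Sum>i\<in>insert j A. noise p (y(j := v)) l i) =
      (of_bool (v = l) - q) + (\<Sum>i\<in>A. noise p y l i)" for y v
  proof -
    have "(\<Sum>i\<in>A. noise p (y(j := v)) l i) = (\<Sum>i\<in>A. noise p y l i)"
      using insert.hyps by (intro sum.cong) (auto simp: noise_def)
    then show ?thesis using insert.hyps by (simp add: noise_def q_def)
  qed
  have int: "integrable (measure_pmf (p j)) g" for g :: "_ \<Rightarrow> real"
    using insert.prems by (intro integrable_measure_pmf_finite) auto
  have "measure_pmf.expectation (Pi_pmf (insert j A) d p) (\<lambda>y. (c + (\<Sum>i\<in>insert j A. noise p y l i))\<^sup>2) =
      measure_pmf.expectation (p j) (\<lambda>v. (c + (of_bool (v = l) - q))\<^sup>2 + W)"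
    using insert.hyps insert.prems
    by (subst expectation_Pi_pmf_insert)
       (auto simp: eq W_def insert.IH[OF insert.prems, simplified] add.assoc[symmetric] simp del: sum.insert)
  \<comment> \<open>An indicator is its own square, so the integrand is affine in it.\<close>
  also have "\<dots> = measure_pmf.expectation (p j) (\<lambda>v. ((c - q)\<^sup>2 + W) + (2 * (c - q) + 1) * indicator {l} v)"
    by (intro Bochner_Integration.integral_cong) (auto simp: power2_eq_square algebra_simps)
  also have "\<dots> = (c - q)\<^sup>2 + W + (2 * (c - q) + 1) * q"
    by (simp add: int q_def measure_pmf_single)
  also have "\<dots> = c\<^sup>2 + (q * (1 - q) + W)" by (simp add: power2_eq_square algebra_simps)
  finally show ?case using insert.hyps by (simp add: q_def W_def)
qed

lemma expectation_block_stat: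
  assumes S: "finite S" "I \<subseteq> S" and L: "finite L" "\<And>i. i \<in> S \<Longrightarrow> set_pmf (p i) \<subseteq> L"
  shows "measure_pmf.expectation (Pi_pmf S d p) (block_stat p L I) =
    (\<Sum>l\<in>L. \<Sum>i\<in>I. pmf (p i) l * (1 - pmf (p i) l)) / card I"
proof -
  have I: "finite I" using S finite_subset by blast
  have fin: "finite (set_pmf (p i))" if "i \<in> I" for i
    using that S L by (meson finite_subset subsetD)
  have "measure_pmf.expectation (Pi_pmf S d p) (block_stat p L I) =
      measure_pmf.expectation (Pi_pmf I d p) (block_stat p L I)"
    by (intro expectation_Pi_pmf_restrict S depends_on_block_stat)
  also have "\<dots> = (\<Sum>l\<in>L. measure_pmf.expectation (Pi_pmf I d p) (\<lambda>y. (0 + (\<Sum>i\<in>I. noise p y l i))\<^sup>2)) / card I"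
    unfolding block_stat_def using finite_set_Pi_pmf[OF I fin]
    by (simp add: integrable_measure_pmf_finite Bochner_Integration.integral_sum)
  finally show ?thesis using expectation_square_noise_sum[OF I fin, where c = 0] by simp
qed

subsection \<open>Uniform control over the dyadic tree\<close>

text \<open>The index \<open>h\<close> is the binary logarithm of the length, not the depth used in
  \<open>dyadic_intervals\<close>; recursion on \<open>h\<close> then makes no reference to
  \<open>N\<close>.\<close>

definition dyadic :: "nat \<Rightarrow> nat \<Rightarrow> nat set" where
  "dyadic h k = {k * 2 ^ h + 1..(k + 1) * 2 ^ h}"

text \<open>Reduces nesting and disjointness to arithmetic of \<open>div\<close>. The shift
  \<open>i - 1\<close> is due to columns being counted from 1, and \<open>1 \<le> i\<close> excludes
  0, which truncated subtraction would place in the first interval.\<close>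

lemma mem_dyadic_iff: "i \<in> dyadic h k \<longleftrightarrow> 1 \<le> i \<and> (i - 1) div 2 ^ h = k"
proof (cases i)
  case 0
  then show ?thesis by (simp add: dyadic_def)
next
  case (Suc j)
  have "k * 2 ^ h \<le> j \<and> j < (k + 1) * 2 ^ h \<longleftrightarrow> j div 2 ^ h = k"
  proof
    assume "k * 2 ^ h \<le> j \<and> j < (k + 1) * 2 ^ h"
    then show "j div 2 ^ h = k" by (intro div_nat_eqI) (auto simp: algebra_simps)
  next
    assume "j div 2 ^ h = k"
    then show "k * 2 ^ h \<le> j \<and> j < (k + 1) * 2 ^ h"
      by (auto simp: div_times_less_eq_dividend dividend_less_div_times)
  qed
  then show ?thesis using Suc by (simp add: dyadic_def Suc_le_eq less_Suc_eq_le)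
qed

lemma finite_dyadic [simp]: "finite (dyadic h k)"
  by (simp add: dyadic_def)

lemma dyadic_nonempty [simp]: "dyadic h k \<noteq> {}"
  by (simp add: dyadic_def)

lemma dyadic_Suc: "dyadic (Suc h) k = dyadic h (2 * k) \<union> dyadic h (2 * k + 1)"
proof -
  have "j div 2 ^ Suc h = k \<longleftrightarrow> j div 2 ^ h = 2 * k \<or> j div 2 ^ h = 2 * k + 1" for j :: nat
    unfolding power_Suc2 div_mult2_eq by linarith
  then show ?thesis by (auto simp: mem_dyadic_iff simp del: power_Suc)
qed

lemma dyadic_halves_disjoint: "dyadic h (2 * k) \<inter> dyadic h (2 * k + 1) = {}"
  by (auto simp: mem_dyadic_iff)

text \<open>Division by \<open>2 ^ h'\<close> factors through division by \<open>2 ^ h\<close>, so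
  the interval of height \<open>h\<close> containing a point determines the one of height
  \<open>h'\<close>.\<close>

lemma dyadic_nested:
  assumes "h \<le> h'"
  shows "dyadic h k \<subseteq> dyadic h' k' \<or> dyadic h k \<inter> dyadic h' k' = {}"
proof -
  have "j div 2 ^ h' = j div 2 ^ h div 2 ^ (h' - h)" for j :: nat
    using assms by (simp add: div_mult2_eq[symmetric] power_add[symmetric])
  then show ?thesis by (auto simp: mem_dyadic_iff)
qed

lemma dyadic_laminar:
  assumes "I \<in> range (case_prod dyadic)" "J \<in> range (case_prod dyadic)" "I \<inter> J \<noteq> {}"
  shows "I \<inter> J \<in> {I, J}"
proof -
  obtain h k h' k' where "I = dyadic h k" "J = dyadic h' k'" using assms by auto
  with assms(3) show ?thesis
    using dyadic_nested[of h h' k k'] dyadic_nested[of h' h k' k] by (cases "h \<le> h'") auto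
qed

text \<open>Unfolding the recursion gives the sum of \<open>\<Prod>I\<in>m. e I\<close> over all
  partitions \<open>m\<close> of the root into dyadic intervals: such a partition is the root alone
  or a pair of partitions of its halves.\<close>

fun tree_sum :: "(nat set \<Rightarrow> real) \<Rightarrow> nat \<Rightarrow> nat \<Rightarrow> real" where
  "tree_sum e 0 k = e (dyadic 0 k)"
| "tree_sum e (Suc h) k = e (dyadic (Suc h) k) + tree_sum e h (2 * k) * tree_sum e h (2 * k + 1)"

lemma tree_sum_nonneg: "(\<And>I. 0 \<le> e I) \<Longrightarrow> 0 \<le> tree_sum e h k"
  by (induction h arbitrary: k) auto

text \<open>One term of a sum of nonnegative terms. By induction on the height, either the root is
  the only block, or each block lies in one half and the product splits.\<close>

lemma prod_le_tree_sum:
  assumes e: "\<And>I. 0 \<le> e I"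
    and "partition_on (dyadic h k) m" "m \<subseteq> range (case_prod dyadic)"
  shows "prod e m \<le> tree_sum e h k"
  using assms(2,3)
proof (induction h arbitrary: k m)
  case 0
  have D: "dyadic 0 k = {k + 1}" by (auto simp: dyadic_def)
  have m: "\<Union>m = {k + 1}" "{} \<notin> m" using 0(1) unfolding D partition_on_def by auto
  have "I = {k + 1}" if "I \<in> m" for I
    using that m by (metis Union_upper subset_singletonD)
  moreover have "m \<noteq> {}" using m(1) by auto
  ultimately have "m = {dyadic 0 k}" unfolding D by blast
  then show ?case by simp
next
  case (Suc h)
  let ?D = "dyadic (Suc h) k" and ?l = "dyadic h (2 * k)" and ?r = "dyadic h (2 * k + 1)"
  have m: "\<Union>m = ?D" "disjoint m" "{} \<notin> m" using Suc.prems(1) by (auto simp: partition_on_def)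
  have "finite m" using Suc.prems(1) finite_elements finite_dyadic by blast
  show ?case
  proof (cases "?D \<in> m")
    case True
    have "I = ?D" if "I \<in> m" for I
    proof (rule ccontr)
      assume "I \<noteq> ?D"
      then have "I \<inter> ?D = {}" using m(2) that True by (auto simp: disjoint_def)
      moreover have "I \<subseteq> ?D" using that m(1) by blast
      ultimately show False using that m(3) by (metis Int_absorb2)
    qed
    with True have "m = {?D}" by blast
    then show ?thesis using tree_sum_nonneg[OF e] by simp
  next
    case False
    define m1 where "m1 = {I \<in> m. I \<subseteq> ?l}"
    define m2 where "m2 = {I \<in> m. I \<subseteq> ?r}"
    have split: "I \<in> m1 \<or> I \<in> m2" if I: "I \<in> m" for I
    proof -
      have sub: "I \<subseteq> ?D" using I m(1) by blast
      have ne: "I \<noteq> {}" "I \<noteq> ?D" using I m(3) False by auto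
      obtain h' k' where I': "I = dyadic h' k'" using I Suc.prems(2) by auto
      \<comment> \<open>A block of height at least \<open>Suc h\<close> that meets the root contains
        it, hence equals it, which \<open>ne\<close> excludes.\<close>
      have "\<not> Suc h \<le> h'"
        using dyadic_nested[of "Suc h" h' k k'] sub ne unfolding I' by blast
      then have "h' \<le> h" by simp
      show ?thesis
      proof (cases "I \<inter> ?l = {}")
        case True
        then have "I \<subseteq> ?r" using sub unfolding dyadic_Suc by blast
        then show ?thesis using I by (simp add: m2_def)
      next
        case False
        then have "I \<subseteq> ?l" using dyadic_nested[OF \<open>h' \<le> h\<close>, of k' "2 * k"] unfolding I' by blast
        then show ?thesis using I by (simp add: m1_def)
      qed
    qed
    have mU: "m = m1 \<union> m2" using split by (auto simp: m1_def m2_def)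
    have disj: "m1 \<inter> m2 = {}"
    proof (rule ccontr)
      assume "m1 \<inter> m2 \<noteq> {}"
      then obtain I where "I \<in> m" "I \<subseteq> ?l \<inter> ?r" unfolding m1_def m2_def by blast
      then show False using m(3) dyadic_halves_disjoint[of h k] by (metis subset_empty)
    qed
    have cover: "x \<in> \<Union>m1 \<or> x \<in> \<Union>m2" if "x \<in> ?D" for x
      using that split unfolding m(1)[symmetric] by blast
    have le: "\<Union>m1 \<subseteq> ?l" "\<Union>m2 \<subseteq> ?r" by (auto simp: m1_def m2_def)
    have "x \<in> \<Union>m1" if "x \<in> ?l" for x
    proof -
      have "x \<notin> ?r" using that dyadic_halves_disjoint[of h k] by blast
      then show ?thesis using cover[of x] le(2) that unfolding dyadic_Suc by blast
    qed
    moreover have "x \<in> \<Union>m2" if "x \<in> ?r" for x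
    proof -
      have "x \<notin> ?l" using that dyadic_halves_disjoint[of h k] by blast
      then show ?thesis using cover[of x] le(1) that unfolding dyadic_Suc by blast
    qed
    ultimately have un: "\<Union>m1 = ?l" "\<Union>m2 = ?r" using le by (simp_all only: set_eq_iff subset_iff) blast+
    have p: "partition_on ?l m1" "partition_on ?r m2"
      unfolding partition_on_def un
      using m(2,3) by (auto simp: m1_def m2_def disjoint_def)
    have sub: "m1 \<subseteq> range (case_prod dyadic)" "m2 \<subseteq> range (case_prod dyadic)"
      using Suc.prems(2) mU by auto
    have "prod e m = prod e m1 * prod e m2"
      using \<open>finite m\<close> disj unfolding mU by (intro prod.union_disjoint) auto
    also have "\<dots> \<le> tree_sum e h (2 * k) * tree_sum e h (2 * k + 1)"
      using Suc.IH[OF p(1) sub(1)] Suc.IH[OF p(2) sub(2)] e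
      by (intro mult_mono prod_nonneg tree_sum_nonneg) auto
    also have "\<dots> \<le> tree_sum e (Suc h) k" using e by simp
    finally show ?thesis .
  qed
qed

text \<open>Supplies the independence of the two factors in the recursion.\<close>

lemma depends_on_tree_sum:
  fixes e :: "nat set \<Rightarrow> (nat \<Rightarrow> 'b) \<Rightarrow> real"
  assumes "\<And>I. depends_on (e I) I"
  shows "depends_on (\<lambda>y. tree_sum (\<lambda>I. e I y) h k) (dyadic h k)"
proof (induction h arbitrary: k)
  case 0
  then show ?case using assms by simp
next
  case (Suc h)
  show ?case
    unfolding depends_on_def
  proof (intro allI impI)
    fix y y' :: "nat \<Rightarrow> 'b" assume eq: "\<forall>i\<in>dyadic (Suc h) k. y i = y' i"
    have "e (dyadic (Suc h) k) y = e (dyadic (Suc h) k) y'"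
      using eq by (intro depends_onD[OF assms]) auto
    moreover have "tree_sum (\<lambda>I. e I y) h (2 * k) = tree_sum (\<lambda>I. e I y') h (2 * k)"
      using eq by (intro depends_onD[OF Suc.IH]) (auto simp: dyadic_Suc)
    moreover have "tree_sum (\<lambda>I. e I y) h (2 * k + 1) = tree_sum (\<lambda>I. e I y') h (2 * k + 1)"
      using eq by (intro depends_onD[OF Suc.IH]) (auto simp: dyadic_Suc)
    ultimately show "tree_sum (\<lambda>I. e I y) (Suc h) k = tree_sum (\<lambda>I. e I y') (Suc h) k"
      by simp
  qed
qed

text \<open>The bound \<open>1/2\<close> is a fixed point of \<open>v \<mapsto> 1/4 + v\<^sup>2\<close>.\<close>

lemma expectation_tree_sum_le:
  assumes S: "finite S" "dyadic h k \<subseteq> S" and fin: "\<And>i. i \<in> S \<Longrightarrow> finite (set_pmf (p i))"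
    and dep: "\<And>I. depends_on (e I) I" and nonneg: "\<And>I y. 0 \<le> e I y"
    and le: "\<And>h k. dyadic h k \<subseteq> S \<Longrightarrow> measure_pmf.expectation (Pi_pmf S d p) (e (dyadic h k)) \<le> 1 / 4"
  shows "measure_pmf.expectation (Pi_pmf S d p) (\<lambda>y. tree_sum (\<lambda>I. e I y) h k) \<le> 1 / 2"
  using S(2)
proof (induction h arbitrary: k)
  case 0
  then show ?case using le[OF 0] by simp
next
  case (Suc h)
  let ?E = "measure_pmf.expectation (Pi_pmf S d p)"
  let ?V = "\<lambda>k y. tree_sum (\<lambda>I. e I y) h k"
  have int: "integrable (measure_pmf (Pi_pmf S d p)) g" for g :: "_ \<Rightarrow> real"
    using S fin by (intro integrable_measure_pmf_finite finite_set_Pi_pmf)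
  have sub: "dyadic h (2 * k) \<subseteq> S" "dyadic h (2 * k + 1) \<subseteq> S"
    using Suc.prems by (auto simp: dyadic_Suc)
  have "?E (\<lambda>y. tree_sum (\<lambda>I. e I y) (Suc h) k) =
      ?E (e (dyadic (Suc h) k)) + ?E (\<lambda>y. ?V (2 * k) y * ?V (2 * k + 1) y)"
    by (simp add: int)
  also have "?E (\<lambda>y. ?V (2 * k) y * ?V (2 * k + 1) y) = ?E (?V (2 * k)) * ?E (?V (2 * k + 1))"
    using S sub fin dep
    by (intro expectation_Pi_pmf_mult[OF _ sub dyadic_halves_disjoint] depends_on_tree_sum) auto
  also have "\<dots> \<le> 1 / 2 * (1 / 2)"
    using nonneg by (intro mult_mono Suc.IH sub integral_nonneg_AE) (auto intro: tree_sum_nonneg)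
  finally show ?case using le[OF Suc.prems] by simp
qed

text \<open>\<open>V\<close> is chosen before the partition, so the bound also holds for a partition
  selected from the data. It follows from \<open>t \<le> exp t\<close> and domination of the product
  by the tree sum; the offset 16 brings the mean of each node down to \<open>exp (- 3 / 2)\<close>,
  below the \<open>1 / 4\<close> that the recursion tolerates.\<close>

lemma exists_uniform_block_stat_bound:
  assumes L: "finite L" "\<And>i. i \<in> {1..2 ^ N} \<Longrightarrow> set_pmf (p i) \<subseteq> L"
  shows "\<exists>V :: (nat \<Rightarrow> 'b) \<Rightarrow> real.
    measure_pmf.expectation (Pi_pmf {1..2 ^ N} d p) V \<le> 1 / 2 \<and>
    (\<forall>m y. partition_on {1..2 ^ N} m \<longrightarrow> m \<subseteq> range (case_prod dyadic) \<longrightarrow>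
      (\<Sum>I\<in>m. block_stat p L I y) \<le> 16 * card m + 8 * V y)"
proof -
  define e where "e = (\<lambda>I y. exp ((block_stat p L I y - 16) / 8))"
  have e_split: "e I = (\<lambda>y. exp (block_stat p L I y / 8) * exp (- 2))" for I
    unfolding e_def exp_add[symmetric] by (simp add: diff_divide_distrib)
  define V where "V = (\<lambda>y. tree_sum (\<lambda>I. e I y) N 0)"
  have root: "dyadic N 0 = {1..2 ^ N}" by (simp add: dyadic_def)
  have fin: "finite (set_pmf (p i))" if "i \<in> {1..2 ^ N}" for i
    using L(1) L(2)[OF that] finite_subset by blast
  have e14: "measure_pmf.expectation (Pi_pmf {1..2 ^ N} d p) (e (dyadic h k)) \<le> 1 / 4"
    if "dyadic h k \<subseteq> {1..2 ^ N}" for h k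
  proof -
    have "measure_pmf.expectation (Pi_pmf {1..2 ^ N} d p) (e (dyadic h k)) =
        measure_pmf.expectation (Pi_pmf {1..2 ^ N} d p) (\<lambda>y. exp (block_stat p L (dyadic h k) y / 8)) * exp (- 2)"
      unfolding e_split by simp
    also have "\<dots> \<le> exp (1 / 2) * exp (- 2)"
      using that L by (intro mult_right_mono exp_moment_block_stat) auto
    also have "\<dots> = 1 / exp (1 / 2 :: real) ^ 3"
    proof -
      have "exp (1 / 2) * exp (- 2) * exp (1 / 2 :: real) ^ 3 = 1"
        unfolding exp_of_nat_mult[symmetric] exp_add[symmetric] by simp
      then show ?thesis by (simp add: eq_divide_eq)
    qed
    \<comment> \<open>The value \<open>13 / 8 = 1 + 1 / 2 + 1 / 8\<close> is the quadratic Taylor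
      bound for \<open>exp (1 / 2)\<close>, and its cube exceeds 4.\<close>
    also have "\<dots> \<le> 1 / (13 / 8) ^ 3"
      using exp_lower_Taylor_quadratic[of "1 / 2"]
      by (intro divide_left_mono power_mono) (auto simp: power2_eq_square)
    also have "\<dots> \<le> 1 / (4 :: real)" by (simp add: power3_eq_cube)
    finally show ?thesis .
  qed
  have "measure_pmf.expectation (Pi_pmf {1..2 ^ N} d p) V \<le> 1 / 2"
    unfolding V_def
  proof (rule expectation_tree_sum_le)
    show "depends_on (e I) I" for I
      unfolding e_def using depends_on_block_stat[of p L I] by (auto simp: depends_on_def)
  qed (use e14 fin in \<open>auto simp: root e_def\<close>)
  moreover have "(\<Sum>I\<in>m. block_stat p L I y) \<le> 16 * card m + 8 * V y"
    if m: "partition_on {1..2 ^ N} m" "m \<subseteq> range (case_prod dyadic)" for m y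
  proof -
    have "finite m" using m(1) finite_elements by blast
    have "((\<Sum>I\<in>m. block_stat p L I y) - 16 * card m) / 8 = (\<Sum>I\<in>m. (block_stat p L I y - 16) / 8)"
      by (simp add: sum_divide_distrib[symmetric] sum_subtractf)
    also have "\<dots> \<le> exp (\<Sum>I\<in>m. (block_stat p L I y - 16) / 8)"
      using exp_ge_add_one_self[of "\<Sum>I\<in>m. (block_stat p L I y - 16) / 8"] by linarith
    also have "\<dots> = (\<Prod>I\<in>m. e I y)"
      using \<open>finite m\<close> by (simp add: exp_sum e_def)
    also have "\<dots> \<le> V y"
      unfolding V_def using m by (intro prod_le_tree_sum) (auto simp: root e_def)
    finally show ?thesis by (simp add: field_simps)
  qed
  ultimately show ?thesis by blast
qed

subsection \<open>Least squares on partitions\<close>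

text \<open>The functions constant on every block form a subspace that contains the generating
  indicators.\<close>

lemma model_space_const:
  assumes "disjoint m" "f \<in> model_space m" "I \<in> m" "i \<in> I" "j \<in> I"
  shows "f i = f j"
proof -
  let ?T = "{f :: nat \<Rightarrow> real. \<forall>I\<in>m. \<forall>i\<in>I. \<forall>j\<in>I. f i = f j}"
  have "subspace ?T"
  proof (rule subspaceI)
    fix f g :: "nat \<Rightarrow> real" assume fg: "f \<in> ?T" "g \<in> ?T"
    have "(f + g) i = (f + g) j" if "I \<in> m" "i \<in> I" "j \<in> I" for I i j
    proof -
      have "f i = f j" "g i = g j" using fg that by blast+
      then show ?thesis by simp
    qed
    then show "f + g \<in> ?T" by blast
  next
    fix c :: real and f :: "nat \<Rightarrow> real" assume f: "f \<in> ?T"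
    have "(c *\<^sub>R f) i = (c *\<^sub>R f) j" if "I \<in> m" "i \<in> I" "j \<in> I" for I i j
    proof -
      have "f i = f j" using f that by blast
      then show ?thesis by (simp add: scaleR_fun_def)
    qed
    then show "c *\<^sub>R f \<in> ?T" by blast
  qed simp
  moreover have "indicator ` m \<subseteq> ?T"
  proof
    fix f :: "nat \<Rightarrow> real" assume "f \<in> indicator ` m"
    then obtain J where J: "J \<in> m" "f = indicator J" by blast
    have "f i = f j" if "I \<in> m" "i \<in> I" "j \<in> I" for I i j
    proof -
      have "i \<in> J \<longleftrightarrow> j \<in> J" using assms(1) J(1) that unfolding disjoint_def by blast
      then show ?thesis by (simp add: J(2) indicator_def)
    qed
    then show "f \<in> ?T" by blast
  qed
  ultimately have "span (indicator ` m) \<subseteq> ?T" by (rule span_minimal[rotated])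
  then show ?thesis using assms unfolding model_space_def by blast
qed

text \<open>At a point of a block \<open>I\<close> the indicators of all other blocks vanish, hence
  so does their span, while the indicator of \<open>I\<close> does not.\<close>

lemma model_dim_eq_card:
  assumes "disjoint m" "{} \<notin> m"
  shows "model_dim m = card m"
proof -
  have disj: "I \<inter> J = {}" if "I \<in> m" "J \<in> m" "I \<noteq> J" for I J
    using assms(1) that by (auto simp: disjoint_def)
  have inj: "inj_on (indicator :: nat set \<Rightarrow> nat \<Rightarrow> real) m"
  proof (rule inj_onI)
    fix I J :: "nat set" assume "(indicator I :: nat \<Rightarrow> real) = indicator J"
    then show "I = J" by (metis indicator_eq_1_iff subsetI subset_antisym)
  qed
  have "independent (indicator ` m :: (nat \<Rightarrow> real) set)"
    unfolding dependent_def
  proof (intro notI, elim bexE)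
    fix b :: "nat \<Rightarrow> real"
    assume "b \<in> indicator ` m" and b: "b \<in> span (indicator ` m - {b})"
    then obtain I where I: "I \<in> m" "b = indicator I" by blast
    obtain i where i: "i \<in> I" using I(1) assms(2) by (metis ex_in_conv)
    have "subspace {f :: nat \<Rightarrow> real. f i = 0}" by (auto simp: subspace_def scaleR_fun_def)
    moreover have "indicator ` m - {b} \<subseteq> {f :: nat \<Rightarrow> real. f i = 0}"
    proof
      fix f :: "nat \<Rightarrow> real" assume "f \<in> indicator ` m - {b}"
      then obtain J where J: "J \<in> m" "J \<noteq> I" "f = indicator J" unfolding I(2) by blast
      then show "f \<in> {f. f i = 0}" using disj[OF J(1) I(1) J(2)] i by (auto simp: indicator_def)
    qed
    ultimately have "span (indicator ` m - {b}) \<subseteq> {f :: nat \<Rightarrow> real. f i = 0}"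
      by (rule span_minimal[rotated])
    then show False using b i unfolding I(2) by auto
  qed
  then show ?thesis
    unfolding model_dim_def model_space_def dim_span
    by (simp add: dim_eq_card_independent card_image[OF inj])
qed

section \<open>Block averages as least squares estimators\<close>

lemma frob_norm_square: "(frob_norm r n t)\<^sup>2 = (\<Sum>l=1..r. \<Sum>i=1..n. (t l i)\<^sup>2)"
  unfolding frob_norm_def
  by (subst sum.swap) (simp add: sum_nonneg)

text \<open>The closed form of \<open>least_squares\<close>, written as a combination of indicators
  so that its rows visibly lie in the span.\<close>

definition block_average :: "nat \<Rightarrow> nat set set \<Rightarrow> rmat \<Rightarrow> rmat" where
  "block_average r m X = (\<lambda>l i. if l \<in> {1..r} then \<Sum>I\<in>m. (\<Sum>j\<in>I. X l j) / card I * indicator I i else 0)"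

context
  fixes n :: nat and m :: "nat set set"
  assumes part: "partition_on {1..n} m"
begin

lemma block_subset: "I \<in> m \<Longrightarrow> I \<subseteq> {1..n}"
  using partition_onD1[OF part] by blast

lemma finite_blocks: "finite m" "I \<in> m \<Longrightarrow> finite I"
  by (rule finite_elements[OF _ part], simp, drule block_subset, erule finite_subset, simp)

lemma sum_blocks: "sum f {1..n} = (\<Sum>I\<in>m. sum f I)"
  by (rule sum.partition[OF _ part]) simp

lemma card_block_pos: "I \<in> m \<Longrightarrow> card I > 0"
  using partition_onD3[OF part] finite_blocks(2)[of I] by (auto simp: card_gt_0_iff)

lemma block_average_eq:
  assumes "l \<in> {1..r}" "I \<in> m" "i \<in> I"
  shows "block_average r m X l i = (\<Sum>j\<in>I. X l j) / card I"
proof -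
  have "i \<in> J \<longleftrightarrow> J = I" if "J \<in> m" for J
    using disjointD[OF partition_onD2[OF part] that assms(2)] assms(3) by blast
  then have "(\<Sum>J\<in>m. (\<Sum>j\<in>J. X l j) / card J * indicator J i) =
      (\<Sum>J\<in>m. if J = I then (\<Sum>j\<in>I. X l j) / card I else 0)"
    by (intro sum.cong) (simp_all add: indicator_def)
  also have "\<dots> = (\<Sum>j\<in>I. X l j) / card I" using assms(2) finite_blocks(1) by simp
  finally show ?thesis using assms(1) by (simp add: block_average_def)
qed

lemma block_average_in_tensor_S: "block_average r m X \<in> tensor_S r n m"
proof -
  have "block_average r m X l i = 0" if "l \<notin> {1..r} \<or> i \<notin> {1..n}" for l i
    using that part unfolding block_average_def partition_on_def
    by (auto intro!: sum.neutral simp: indicator_def)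
  moreover have "block_average r m X l \<in> model_space m" if "l \<in> {1..r}" for l
  proof -
    define c where "c = (\<lambda>I. (\<Sum>j\<in>I. X l j) / card I)"
    have "(\<lambda>i. \<Sum>I\<in>m'. c I * indicator I i) \<in> span (indicator ` m)" if "finite m'" "m' \<subseteq> m" for m'
      using that
    proof (induction m' rule: finite_induct)
      case empty
      then show ?case using span_zero[of "indicator ` m :: (nat \<Rightarrow> real) set"] by (simp add: zero_fun_def)
    next
      case (insert I m')
      have "c I *\<^sub>R indicator I + (\<lambda>i. \<Sum>I\<in>m'. c I * indicator I i) \<in> span (indicator ` m :: (nat \<Rightarrow> real) set)"
        using insert by (intro span_add span_scale) (auto intro: span_base)
      also have "c I *\<^sub>R indicator I + (\<lambda>i. \<Sum>I\<in>m'. c I * indicator I i) =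
          (\<lambda>i. \<Sum>I\<in>insert I m'. c I * indicator I i)"
        unfolding plus_fun_def scaleR_fun_def sum.insert[OF insert.hyps] by simp
      finally show ?case .
    qed
    from this[OF finite_blocks(1) subset_refl] show ?thesis
      using that unfolding model_space_def block_average_def c_def by simp
  qed
  ultimately show ?thesis by (simp add: tensor_S_def mat_space_def)
qed

lemma tensor_S_const:
  assumes "t \<in> tensor_S r n m" "l \<in> {1..r}" "I \<in> m" "i \<in> I" "j \<in> I"
  shows "t l i = t l j"
  using model_space_const[of m "t l" I i j] part assms by (auto simp: tensor_S_def partition_on_def)

lemma sum_block_average:
  assumes "l \<in> {1..r}" "I \<in> m"
  shows "(\<Sum>i\<in>I. block_average r m X l i) = (\<Sum>i\<in>I. X l i)"
  using card_block_pos[OF assms(2)] by (simp add: block_average_eq[OF assms])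

text \<open>On each block the residual of the average sums to zero and the difference of the average
  and \<open>t\<close> is constant, so the cross term vanishes.\<close>

lemma pythagoras_block_average:
  assumes t: "t \<in> tensor_S r n m"
  shows "(frob_norm r n (X - t))\<^sup>2 =
    (frob_norm r n (X - block_average r m X))\<^sup>2 + (frob_norm r n (block_average r m X - t))\<^sup>2"
proof -
  let ?a = "block_average r m X"
  have "(\<Sum>i=1..n. ((X - t) l i)\<^sup>2) = (\<Sum>i=1..n. ((X - ?a) l i)\<^sup>2) + (\<Sum>i=1..n. ((?a - t) l i)\<^sup>2)"
    if l: "l \<in> {1..r}" for l
  proof -
    have "(\<Sum>i=1..n. (X l i - ?a l i) * (?a l i - t l i)) = 0"
    proof -
      have "(\<Sum>i\<in>I. (X l i - ?a l i) * (?a l i - t l i)) = 0" if I: "I \<in> m" for I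
      proof -
        obtain j where j: "j \<in> I" using card_block_pos[OF I] by fastforce
        have "(\<Sum>i\<in>I. (X l i - ?a l i) * (?a l i - t l i)) =
            (\<Sum>i\<in>I. (X l i - ?a l i) * (?a l j - t l j))"
          using tensor_S_const[OF t l I _ j] tensor_S_const[OF block_average_in_tensor_S l I _ j]
          by (intro sum.cong) (auto simp del: atLeastAtMost_iff)
        also have "\<dots> = 0"
          unfolding sum_distrib_right[symmetric] sum_subtractf sum_block_average[OF l I] by simp
        finally show ?thesis .
      qed
      then show ?thesis unfolding sum_blocks by simp
    qed
    moreover have "((X - t) l i)\<^sup>2 = ((X - ?a) l i)\<^sup>2 + ((?a - t) l i)\<^sup>2 +
        2 * ((X l i - ?a l i) * (?a l i - t l i))" for i
      by (simp add: power2_eq_square algebra_simps)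
    ultimately show ?thesis by (simp add: sum.distrib sum_distrib_left[symmetric])
  qed
  then show ?thesis unfolding frob_norm_square by (simp add: sum.distrib)
qed

text \<open>\<open>arg_min_on\<close> picks an unspecified minimizer. By Pythagoras any minimizer is
  at distance zero from the average, and outside the index range both vanish.\<close>

lemma least_squares_eq_block_average: "least_squares r n m X = block_average r m X"
proof -
  let ?a = "block_average r m X" and ?f = "\<lambda>t. (frob_norm r n (X - t))\<^sup>2"
  define t where "t = least_squares r n m X"
  have "is_arg_min ?f (\<lambda>t. t \<in> tensor_S r n m) ?a"
    unfolding is_arg_min_linorder
  proof (intro conjI allI impI block_average_in_tensor_S)
    fix t assume "t \<in> tensor_S r n m"
    from pythagoras_block_average[OF this, of X] show "?f ?a \<le> ?f t"
      by (metis le_add_same_cancel1 zero_le_power2)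
  qed
  then have "is_arg_min ?f (\<lambda>t. t \<in> tensor_S r n m) t"
    unfolding t_def least_squares_def arg_min_on_def arg_min_def
    by (rule someI[of "is_arg_min ?f (\<lambda>t. t \<in> tensor_S r n m)"])
  then have t: "t \<in> tensor_S r n m" and "?f t \<le> ?f ?a"
    using block_average_in_tensor_S by (auto simp: is_arg_min_linorder)
  then have "(frob_norm r n (?a - t))\<^sup>2 \<le> 0"
    using pythagoras_block_average[OF t, of X] by linarith
  then have "(\<Sum>l=1..r. \<Sum>i=1..n. ((?a - t) l i)\<^sup>2) = 0"
    unfolding frob_norm_square by (intro antisym sum_nonneg) simp_all
  then have "?a l i = t l i" if "l \<in> {1..r}" "i \<in> {1..n}" for l i
    using that by (simp add: sum_nonneg_eq_0_iff sum_nonneg)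
  moreover have "?a l i = t l i" if "\<not> (l \<in> {1..r} \<and> i \<in> {1..n})" for l i
    using that t block_average_in_tensor_S[of r X] by (auto simp: tensor_S_def mat_space_def)
  ultimately have "?a = t" by (intro ext) blast
  then show ?thesis by (simp add: t_def)
qed

text \<open>Where \<open>d\<close> is constant only the block sums of \<open>e\<close> matter. The
  small weight \<open>1 / 4\<close> on the norm of \<open>d\<close> lets part of it be absorbed
  later.\<close>

lemma inner_product_le_block_sums:
  fixes e d :: rmat
  assumes d: "\<And>l I i j. l \<in> {1..r} \<Longrightarrow> I \<in> m \<Longrightarrow> i \<in> I \<Longrightarrow> j \<in> I \<Longrightarrow> d l i = d l j"
  shows "2 * (\<Sum>l=1..r. \<Sum>i=1..n. e l i * d l i) \<le>
    4 * (\<Sum>I\<in>m. (\<Sum>l=1..r. (\<Sum>i\<in>I. e l i)\<^sup>2) / card I) + (frob_norm r n d)\<^sup>2 / 4"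
proof -
  have blk: "2 * (\<Sum>i\<in>I. e l i * d l i) \<le> 4 * ((\<Sum>i\<in>I. e l i)\<^sup>2 / card I) + (\<Sum>i\<in>I. (d l i)\<^sup>2) / 4"
    if l: "l \<in> {1..r}" and I: "I \<in> m" for l I
  proof -
    obtain j where j: "j \<in> I" using card_block_pos[OF I] by fastforce
    define c E k where "c = d l j" and "E = (\<Sum>i\<in>I. e l i)" and "k = real (card I)"
    have c: "d l i = c" if "i \<in> I" for i unfolding c_def by (rule d[OF l I that j])
    have k: "k > 0" using card_block_pos[OF I] by (simp add: k_def)
    \<comment> \<open>This is the square of \<open>2 * a - b / 2\<close> for
      \<open>a = E / sqrt k\<close> and \<open>b = sqrt k * c\<close>.\<close>
    have "0 \<le> (4 * E - k * c)\<^sup>2 / (4 * k)" using k by simp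
    also have "\<dots> = 4 * (E\<^sup>2 / k) + k * c\<^sup>2 / 4 - 2 * (E * c)"
      using k by (simp add: power2_eq_square field_simps)
    finally have "2 * (E * c) \<le> 4 * (E\<^sup>2 / k) + k * c\<^sup>2 / 4" by simp
    moreover have "(\<Sum>i\<in>I. e l i * d l i) = E * c" unfolding E_def by (simp add: c sum_distrib_right)
    moreover have "(\<Sum>i\<in>I. (d l i)\<^sup>2) = k * c\<^sup>2" unfolding k_def by (simp add: c)
    ultimately show ?thesis unfolding E_def k_def by simp
  qed
  have "2 * (\<Sum>l=1..r. \<Sum>i=1..n. e l i * d l i) = (\<Sum>l=1..r. \<Sum>I\<in>m. 2 * (\<Sum>i\<in>I. e l i * d l i))"
    unfolding sum_blocks sum_distrib_left ..
  also have "\<dots> \<le> (\<Sum>l=1..r. \<Sum>I\<in>m. 4 * ((\<Sum>i\<in>I. e l i)\<^sup>2 / card I) + (\<Sum>i\<in>I. (d l i)\<^sup>2) / 4)"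
    by (intro sum_mono blk)
  also have "\<dots> = 4 * (\<Sum>l=1..r. \<Sum>I\<in>m. (\<Sum>i\<in>I. e l i)\<^sup>2 / card I) + (frob_norm r n d)\<^sup>2 / 4"
    unfolding frob_norm_square sum_blocks sum.distrib sum_distrib_left sum_divide_distrib ..
  also have "(\<Sum>l=1..r. \<Sum>I\<in>m. (\<Sum>i\<in>I. e l i)\<^sup>2 / card I) = (\<Sum>I\<in>m. (\<Sum>l=1..r. (\<Sum>i\<in>I. e l i)\<^sup>2) / card I)"
    by (subst sum.swap) (simp add: sum_divide_distrib)
  finally show ?thesis .
qed

text \<open>Cauchy-Schwarz on each block and row: projecting onto blockwise constants does not
  increase the norm.\<close>

lemma block_sums_le_frob_norm:
  "(\<Sum>I\<in>m. (\<Sum>l=1..r. (\<Sum>i\<in>I. t l i)\<^sup>2) / card I) \<le> (frob_norm r n t)\<^sup>2"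
proof -
  have "(\<Sum>I\<in>m. (\<Sum>l=1..r. (\<Sum>i\<in>I. t l i)\<^sup>2) / card I) \<le> (\<Sum>I\<in>m. \<Sum>l=1..r. \<Sum>i\<in>I. (t l i)\<^sup>2)"
    unfolding sum_divide_distrib
  proof (intro sum_mono)
    fix I l assume "I \<in> m"
    then show "(\<Sum>i\<in>I. t l i)\<^sup>2 / card I \<le> (\<Sum>i\<in>I. (t l i)\<^sup>2)"
      using card_block_pos[of I] sum_squared_le_sum_of_squares[of "t l" I]
      by (simp add: divide_le_eq)
  qed
  also have "\<dots> = (frob_norm r n t)\<^sup>2"
    unfolding frob_norm_square sum_blocks by (rule sum.swap)
  finally show ?thesis .
qed

end

subsection \<open>Oracle inequality for dyadic partitions\<close>

lemma dyadic_intervals_subset: "dyadic_intervals N \<subseteq> range (case_prod dyadic)"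
  unfolding dyadic_intervals_def dyadic_def by (auto simp: image_def)

lemma dyadic_partitionsD:
  assumes "m \<in> dyadic_partitions N"
  shows "partition_on {1..2 ^ N} m" "m \<subseteq> range (case_prod dyadic)" "model_dim m = card m" "card m \<ge> 1"
proof -
  show p: "partition_on {1..2 ^ N} m" and "m \<subseteq> range (case_prod dyadic)"
    using assms dyadic_intervals_subset by (auto simp: dyadic_partitions_def)
  then show "model_dim m = card m" by (intro model_dim_eq_card) (auto simp: partition_on_def)
  have "m \<noteq> {}" using p by (auto simp: partition_on_def)
  then show "card m \<ge> 1" using finite_blocks(1)[OF p] by (simp add: Suc_le_eq card_gt_0_iff)
qed

text \<open>Dyadic intervals form a laminar family, so every block of a common refinement already
  belongs to one of the two partitions; hence dimensions are subadditive.\<close>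

lemma exists_dyadic_common_refinement:
  assumes m: "partition_on A m" "m \<subseteq> range (case_prod dyadic)"
    and m': "partition_on A m'" "m' \<subseteq> range (case_prod dyadic)"
    and A: "finite A"
  obtains q where "partition_on A q" "q \<subseteq> range (case_prod dyadic)" "card q \<le> card m + card m'"
    "\<And>K. K \<in> q \<Longrightarrow> \<exists>I\<in>m. K \<subseteq> I" "\<And>K. K \<in> q \<Longrightarrow> \<exists>I\<in>m'. K \<subseteq> I"
proof
  let ?q = "common_refinement {m, m'}"
  show "partition_on A ?q" using m m' by (intro partition_on_common_refinement) auto
  show "\<exists>I\<in>m. K \<subseteq> I" "\<exists>I\<in>m'. K \<subseteq> I" if "K \<in> ?q" for K
    using common_refinement_exists[OF that] by auto
  have sub: "?q \<subseteq> m \<union> m'"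
  proof
    fix K assume K: "K \<in> ?q"
    then obtain f where f: "f m \<in> m" "f m' \<in> m'" "K = f m \<inter> f m'" "K \<noteq> {}"
      by (auto simp: common_refinement)
    then have "K \<in> {f m, f m'}"
      using dyadic_laminar[of "f m" "f m'"] m(2) m'(2) by (metis subsetD)
    then show "K \<in> m \<union> m'" using f by auto
  qed
  then show "?q \<subseteq> range (case_prod dyadic)" using m(2) m'(2) by blast
  have "finite (m \<union> m')" using finite_elements[OF A] m(1) m'(1) by auto
  then show "card ?q \<le> card m + card m'"
    using card_mono[OF _ sub] card_Un_le[of m m'] by linarith
qed

text \<open>A deterministic statement: \<open>X\<close> and \<open>s\<close> are arbitrary, and
  chance enters only through \<open>V\<close>. Comparing the criterion at \<open>k\<close> and
  \<open>m\<close> leaves the inner product of \<open>X - s\<close> with a difference that is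
  constant on the blocks of the common refinement.\<close>

lemma oracle_inequality_pointwise:
  fixes X s :: rmat and c0 V :: real
  assumes m: "m \<in> dyadic_partitions N" and k: "k \<in> dyadic_partitions N" and c0: "c0 \<ge> 64"
    and n: "n = 2 ^ N"
    and min: "(frob_norm r n (X - least_squares r n k X))\<^sup>2 + c0 * model_dim k
      \<le> (frob_norm r n (X - least_squares r n m X))\<^sup>2 + c0 * model_dim m"
    and V: "\<And>q. partition_on {1..2 ^ N} q \<Longrightarrow> q \<subseteq> range (case_prod dyadic) \<Longrightarrow>
      (\<Sum>I\<in>q. (\<Sum>l=1..r. (\<Sum>i\<in>I. X l i - s l i)\<^sup>2) / card I) \<le> 16 * card q + 8 * V"
  shows "(frob_norm r n (s - least_squares r n k X))\<^sup>2 \<le>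
    3 * (frob_norm r n (s - least_squares r n m X))\<^sup>2 + 2 * (c0 + 64) * model_dim m + 64 * V"
proof -
  note dm = dyadic_partitionsD[OF m] and dk = dyadic_partitionsD[OF k]
  define u where "u = least_squares r n k X"
  define v where "v = least_squares r n m X"
  have u: "u \<in> tensor_S r n k" and v: "v \<in> tensor_S r n m"
    using dm(1) dk(1) unfolding u_def v_def n
    by (simp_all add: least_squares_eq_block_average block_average_in_tensor_S)
  obtain q where q: "partition_on {1..2 ^ N} q" "q \<subseteq> range (case_prod dyadic)" "card q \<le> card m + card k"
    and qm: "\<And>K. K \<in> q \<Longrightarrow> \<exists>I\<in>m. K \<subseteq> I" and qk: "\<And>K. K \<in> q \<Longrightarrow> \<exists>I\<in>k. K \<subseteq> I"
    using exists_dyadic_common_refinement[OF dm(1,2) dk(1,2)] by auto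
  let ?F = "\<lambda>t. (frob_norm r n t)\<^sup>2" and ?ip = "\<lambda>a b. \<Sum>l=1..r. \<Sum>i=1..n. (a :: rmat) l i * (b :: rmat) l i"
  \<comment> \<open>Turns residuals into losses; the term \<open>?F (X - s)\<close> cancels in the
    comparison.\<close>
  have expand: "?F (X - t) = ?F (X - s) + 2 * ?ip (X - s) (s - t) + ?F (s - t)" for t
  proof -
    have "((X - t) l i)\<^sup>2 = ((X - s) l i)\<^sup>2 + 2 * ((X - s) l i * (s - t) l i) + ((s - t) l i)\<^sup>2" for l i
      by (simp add: power2_eq_square algebra_simps)
    then show ?thesis unfolding frob_norm_square by (simp only: sum.distrib sum_distrib_left[symmetric])
  qed
  have "?ip (X - s) (s - v) - ?ip (X - s) (s - u) = ?ip (X - s) (u - v)"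
    unfolding sum_subtractf[symmetric] by (simp add: algebra_simps)
  then have 1: "?F (s - u) + c0 * model_dim k \<le> ?F (s - v) + 2 * ?ip (X - s) (u - v) + c0 * model_dim m"
    using min expand[of u] expand[of v] unfolding u_def[symmetric] v_def[symmetric] by linarith
  have const: "(u - v) l i = (u - v) l j" if l: "l \<in> {1..r}" and K: "K \<in> q" "i \<in> K" "j \<in> K" for l K i j
  proof -
    obtain I J where "I \<in> m" "K \<subseteq> I" "J \<in> k" "K \<subseteq> J" using qm qk K(1) by blast
    then have "v l i = v l j" "u l i = u l j"
      using tensor_S_const[OF _ v l, of I i j] tensor_S_const[OF _ u l, of J i j] dm(1) dk(1) K
      unfolding n by (auto simp del: atLeastAtMost_iff)
    then show ?thesis by simp
  qed
  have 2: "2 * ?ip (X - s) (u - v) \<le> 4 * (16 * card q + 8 * V) + ?F (u - v) / 4"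
  proof -
    have "2 * ?ip (X - s) (u - v) \<le>
        4 * (\<Sum>I\<in>q. (\<Sum>l=1..r. (\<Sum>i\<in>I. (X - s) l i)\<^sup>2) / card I) + ?F (u - v) / 4"
      unfolding n by (rule inner_product_le_block_sums[OF q(1) const])
    then show ?thesis using V[OF q(1,2)] by simp
  qed
  have 3: "?F (u - v) \<le> 2 * ?F (s - u) + 2 * ?F (s - v)"
  proof -
    have "((u - v) l i)\<^sup>2 \<le> 2 * ((s - u) l i)\<^sup>2 + 2 * ((s - v) l i)\<^sup>2" for l i
    proof -
      have "0 \<le> ((s l i - u l i) + (s l i - v l i))\<^sup>2" by simp
      then show ?thesis by (simp add: power2_eq_square algebra_simps)
    qed
    then show ?thesis
      unfolding frob_norm_square sum_distrib_left sum.distrib[symmetric] by (intro sum_mono) 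
  qed
  have 4: "real (card q) \<le> model_dim m + model_dim k" using q(3) dm(3) dk(3) by simp
  have 5: "64 * real (model_dim k) \<le> c0 * model_dim k" using c0 by (intro mult_right_mono) auto
  \<comment> \<open>By \<open>3\<close>, half of the loss of \<open>u\<close> moves to the left; by
    \<open>5\<close>, the penalty of \<open>k\<close> pays for the part
    \<open>64 * model_dim k\<close> of the bound on \<open>64 * card q\<close>. Doubling gives the
    stated constants.\<close>
  show ?thesis
    using 1 2 3 4 5 unfolding u_def[symmetric] v_def[symmetric] by (simp add: algebra_simps)
qed

section \<open>Risk bounds under a fixed distribution matrix\<close>

context
  fixes r n N :: nat and s :: rmat and p :: "nat \<Rightarrow> nat pmf"
  assumes s: "s \<in> distribution_matrices r n" and n: "n = 2 ^ N"
  defines "p \<equiv> \<lambda>i. embed_pmf (\<lambda>l. s l i)"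
begin

lemma pmf_p: "i \<in> {1..n} \<Longrightarrow> pmf (p i) l = s l i"
  unfolding p_def by (rule pmf_embed_column[OF s])

lemma set_pmf_p: "i \<in> {1..n} \<Longrightarrow> set_pmf (p i) \<subseteq> {1..r}"
  using s pmf_p[of i] unfolding set_pmf_eq distribution_matrices_def mat_space_def by force

lemma law_eq: "law n s = Pi_pmf {1..n} 0 p"
  unfolding law_def p_def ..

lemma set_law_subset: "set_pmf (law n s) \<subseteq> outcomes r n"
proof
  fix y assume "y \<in> set_pmf (law n s)"
  then have "y \<in> PiE_dflt {1..n} 0 (set_pmf \<circ> p)" unfolding law_eq by (simp add: set_Pi_pmf)
  then show "y \<in> outcomes r n"
    unfolding outcomes_def PiE_dflt_def using set_pmf_p by fastforce
qed

lemma finite_set_law: "finite (set_pmf (law n s))"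
  unfolding law_eq using finite_subset[OF set_pmf_p] by (intro finite_set_Pi_pmf) simp_all

lemma noise_eq: "l \<in> {1..r} \<Longrightarrow> i \<in> {1..n} \<Longrightarrow> noise p y l i = obs_matrix r n y l i - s l i"
  by (simp add: noise_def obs_matrix_def pmf_p)

lemma block_stat_eq:
  assumes "I \<subseteq> {1..n}"
  shows "block_stat p {1..r} I y = (\<Sum>l=1..r. (\<Sum>i\<in>I. obs_matrix r n y l i - s l i)\<^sup>2) / card I"
  unfolding block_stat_def
  by (intro arg_cong2[where f = "(/)"] sum.cong arg_cong[where f = "\<lambda>x. x\<^sup>2"] refl noise_eq)
     (use assms in auto)

lemma entry_le_max_norm:
  assumes "l \<in> {1..r}" "i \<in> {1..n}"
  shows "s l i \<le> max_norm r n s"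
proof -
  have "{\<bar>s l i\<bar> | l i. l \<in> {1..r} \<and> i \<in> {1..n}} = (\<lambda>(l, i). \<bar>s l i\<bar>) ` ({1..r} \<times> {1..n})"
    by (auto simp del: atLeastAtMost_iff)
  then have "finite {\<bar>s l i\<bar> | l i. l \<in> {1..r} \<and> i \<in> {1..n}}" by simp
  then have "\<bar>s l i\<bar> \<le> max_norm r n s"
    unfolding max_norm_def by (rule Max_ge) (use assms in blast)
  then show ?thesis by simp
qed

text \<open>Averaging preserves block sums, so up to sign the loss has the same block sums as the
  noise and dominates the total of the block statistics. Each of these has mean at least
  \<open>1 - max_norm r n s\<close>, since \<open>1 - pmf (p i) l\<close> is at least that and the
  probabilities sum to 1.\<close>

lemma risk_lower_bound:
  assumes m: "m \<in> dyadic_partitions N"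
  shows "(1 - max_norm r n s) * model_dim m \<le> expect n s (\<lambda>y. (frob_norm r n (s - s_hat r n m y))\<^sup>2)"
proof -
  note dm = dyadic_partitionsD[OF m, folded n]
  let ?M = "max_norm r n s"
  have sub: "I \<subseteq> {1..n}" if "I \<in> m" for I using dm(1) that by (auto simp: partition_on_def)
  have "1 - ?M \<le> measure_pmf.expectation (law n s) (block_stat p {1..r} I)" if I: "I \<in> m" for I
  proof -
    have k: "real (card I) > 0" using card_block_pos[OF dm(1) I] by simp
    have "(1 - ?M) * card I = (\<Sum>i\<in>I. \<Sum>l=1..r. pmf (p i) l * (1 - ?M))"
    proof -
      have "(\<Sum>l=1..r. pmf (p i) l) = 1" if "i \<in> I" for i
        using set_pmf_p[of i] sub[OF I] that by (intro sum_pmf_eq_1) blast+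
      then show ?thesis by (simp add: sum_distrib_right[symmetric])
    qed
    also have "\<dots> \<le> (\<Sum>i\<in>I. \<Sum>l=1..r. pmf (p i) l * (1 - pmf (p i) l))"
      using sub[OF I] entry_le_max_norm
      by (intro sum_mono mult_left_mono pmf_nonneg) (auto simp: pmf_p subset_iff)
    also have "\<dots> = (\<Sum>l=1..r. \<Sum>i\<in>I. pmf (p i) l * (1 - pmf (p i) l))"
      by (rule sum.swap)
    also have "\<dots> = measure_pmf.expectation (law n s) (block_stat p {1..r} I) * card I"
      unfolding law_eq using k
      by (subst expectation_block_stat[OF finite_atLeastAtMost sub[OF I] finite_atLeastAtMost set_pmf_p]) auto
    finally show ?thesis using k by simp
  qed
  then have "(\<Sum>I\<in>m. 1 - ?M) \<le> (\<Sum>I\<in>m. measure_pmf.expectation (law n s) (block_stat p {1..r} I))"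
    by (intro sum_mono)
  also have "\<dots> = measure_pmf.expectation (law n s) (\<lambda>y. \<Sum>I\<in>m. block_stat p {1..r} I y)"
    by (simp add: finite_set_law integrable_measure_pmf_finite)
  also have "\<dots> \<le> expect n s (\<lambda>y. (frob_norm r n (s - s_hat r n m y))\<^sup>2)"
    unfolding expect_def
  proof (rule expectation_mono_finite[OF finite_set_law])
    fix y
    let ?t = "s - s_hat r n m y"
    have "block_stat p {1..r} I y = (\<Sum>l=1..r. (\<Sum>i\<in>I. ?t l i)\<^sup>2) / card I" if I: "I \<in> m" for I
    proof -
      have "(\<Sum>i\<in>I. obs_matrix r n y l i - s l i)\<^sup>2 = (\<Sum>i\<in>I. ?t l i)\<^sup>2" if "l \<in> {1..r}" for l
        by (simp add: least_squares_eq_block_average[OF dm(1)] sum_subtractf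
            sum_block_average[OF dm(1) that I] power2_commute)
      then show ?thesis unfolding block_stat_eq[OF sub[OF I]] by simp
    qed
    then show "(\<Sum>I\<in>m. block_stat p {1..r} I y) \<le> (frob_norm r n ?t)\<^sup>2"
      using block_sums_le_frob_norm[OF dm(1), of ?t r] by simp
  qed
  finally show ?thesis by (simp add: dm(3) mult.commute)
qed

text \<open>The expectation of \<open>oracle_inequality_pointwise\<close>; the term
  \<open>64 * V\<close> has mean at most 32.\<close>

lemma risk_upper_bound:
  assumes m: "m \<in> dyadic_partitions N" and c0: "c0 \<ge> 64"
    and pen: "\<forall>m\<in>dyadic_partitions N. pen m = c0 * real (model_dim m)"
    and sel: "selects_minimizer r N pen m_hat"
  shows "expect n s (\<lambda>y. (frob_norm r n (s - s_tilde r n m_hat y))\<^sup>2) \<le>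
    3 * expect n s (\<lambda>y. (frob_norm r n (s - s_hat r n m y))\<^sup>2) + 2 * (c0 + 64) * model_dim m + 32"
proof -
  have "finite {1..r}" by simp
  from exists_uniform_block_stat_bound[where p = p and d = 0, OF this set_pmf_p[unfolded n]]
  obtain V :: "(nat \<Rightarrow> nat) \<Rightarrow> real"
    where "measure_pmf.expectation (Pi_pmf {1..2 ^ N} 0 p) V \<le> 1 / 2 \<and>
      (\<forall>q y. partition_on {1..2 ^ N} q \<longrightarrow> q \<subseteq> range (case_prod dyadic) \<longrightarrow>
        (\<Sum>I\<in>q. block_stat p {1..r} I y) \<le> 16 * card q + 8 * V y)"
    by (rule exE)
  then have EV: "measure_pmf.expectation (Pi_pmf {1..2 ^ N} 0 p) V \<le> 1 / 2"
    and V: "\<And>q y. partition_on {1..2 ^ N} q \<Longrightarrow> q \<subseteq> range (case_prod dyadic) \<Longrightarrow>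
      (\<Sum>I\<in>q. block_stat p {1..r} I y) \<le> 16 * card q + 8 * V y"
    by simp_all
  have EV: "measure_pmf.expectation (law n s) V \<le> 1 / 2"
    using EV unfolding law_eq unfolding n .
  let ?R = "\<lambda>y. (frob_norm r n (s - s_hat r n m y))\<^sup>2"
  have int: "integrable (measure_pmf (law n s)) f" for f :: "_ \<Rightarrow> real"
    by (intro integrable_measure_pmf_finite finite_set_law)
  have "expect n s (\<lambda>y. (frob_norm r n (s - s_tilde r n m_hat y))\<^sup>2) \<le>
      expect n s (\<lambda>y. 3 * ?R y + 2 * (c0 + 64) * model_dim m + 64 * V y)"
    unfolding expect_def s_tilde_def
  proof (rule expectation_mono_finite[OF finite_set_law])
    fix y assume "y \<in> set_pmf (law n s)"
    \<comment> \<open>The selection rule is constrained on \<open>outcomes\<close> only, which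
      contains the support of the law.\<close>
    then have "is_arg_min (\<lambda>m. (frob_norm r n (obs_matrix r n y - s_hat r n m y))\<^sup>2 + pen m)
        (\<lambda>m. m \<in> dyadic_partitions N) (m_hat y)"
      using sel set_law_subset unfolding selects_minimizer_def n by blast
    then have k: "m_hat y \<in> dyadic_partitions N"
      and min: "(frob_norm r n (obs_matrix r n y - s_hat r n (m_hat y) y))\<^sup>2 + c0 * model_dim (m_hat y)
        \<le> (frob_norm r n (obs_matrix r n y - s_hat r n m y))\<^sup>2 + c0 * model_dim m"
      using m pen by (auto simp: is_arg_min_linorder)
    show "(frob_norm r n (s - s_hat r n (m_hat y) y))\<^sup>2 \<le> 3 * ?R y + 2 * (c0 + 64) * model_dim m + 64 * V y"
    proof (rule oracle_inequality_pointwise[OF m k c0 n min])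
      fix q assume q: "partition_on {1..2 ^ N} q" "q \<subseteq> range (case_prod dyadic)"
      have "I \<subseteq> {1..n}" if "I \<in> q" for I using q(1) that unfolding n by (auto simp: partition_on_def)
      then have "(\<Sum>I\<in>q. block_stat p {1..r} I y) =
          (\<Sum>I\<in>q. (\<Sum>l=1..r. (\<Sum>i\<in>I. obs_matrix r n y l i - s l i)\<^sup>2) / card I)"
        by (intro sum.cong refl block_stat_eq)
      then show "(\<Sum>I\<in>q. (\<Sum>l=1..r. (\<Sum>i\<in>I. obs_matrix r n y l i - s l i)\<^sup>2) / card I) \<le> 16 * card q + 8 * V y"
        using V[OF q, of y] by simp
    qed
  qed
  also have "\<dots> = 3 * expect n s ?R + 2 * (c0 + 64) * model_dim m + 64 * measure_pmf.expectation (law n s) V"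
    unfolding expect_def by (simp add: int)
  finally show ?thesis using EV by simp
qed

end

section \<open>The oracle inequality in expectation\<close>

lemma atLeastAtMost_in_dyadic_partitions: "{{1..2 ^ N}} \<in> dyadic_partitions N"
proof -
  have "{1..2 ^ N} \<in> dyadic_intervals N"
    unfolding dyadic_intervals_def by (intro CollectI exI[of _ 0]) simp
  then show ?thesis by (simp add: dyadic_partitions_def partition_on_def)
qed

theorem proposition1:
  shows "\<exists>c_star>0. \<exists>C :: real \<Rightarrow> real. (\<forall>c0>c_star. C c0 > 0) \<and>
    (\<forall>(c0 :: real) (r :: nat) (N :: nat) (n :: nat) (s :: rmat)
       (pen :: nat set set \<Rightarrow> real) (m_hat :: (nat \<Rightarrow> nat) \<Rightarrow> nat set set).
       c0 > c_star \<longrightarrow> r \<ge> 2 \<longrightarrow> n = 2 ^ N \<longrightarrow>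
       s \<in> distribution_matrices r n \<longrightarrow>
       max_norm r n s < 1 \<longrightarrow>
       (\<forall>m\<in>dyadic_partitions N. pen m = c0 * real (model_dim m)) \<longrightarrow>
       selects_minimizer r N pen m_hat \<longrightarrow>
       expect n s (\<lambda>y. (frob_norm r n (s - s_tilde r n m_hat y))\<^sup>2)
         \<le> C c0 * inverse (1 - max_norm r n s) *
           (INF m\<in>dyadic_partitions N. expect n s (\<lambda>y. (frob_norm r n (s - s_hat r n m y))\<^sup>2)))"
proof (rule exI[of _ 64], intro conjI exI[of _ "\<lambda>c0. 2 * c0 + 163"] allI impI)
  show "(0 :: real) < 64" by simp
  show "0 < 2 * c0 + 163" if "c0 > 64" for c0 :: real using that by simp
next
  fix c0 :: real and r N n :: nat and s :: rmat and pen m_hat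
  assume c0: "c0 > 64" and n: "n = 2 ^ N" and s: "s \<in> distribution_matrices r n"
    and M: "max_norm r n s < 1"
    and pen: "\<forall>m\<in>dyadic_partitions N. pen m = c0 * real (model_dim m)"
    and sel: "selects_minimizer r N pen m_hat"
  define \<delta> where "\<delta> = 1 - max_norm r n s"
  \<comment> \<open>The constant is \<open>3 + 2 * (c0 + 64) + 32\<close>, the sum of the
    coefficients in \<open>risk_upper_bound\<close>.\<close>
  define K where "K = (2 * c0 + 163) * inverse \<delta>"
  define T where "T = expect n s (\<lambda>y. (frob_norm r n (s - s_tilde r n m_hat y))\<^sup>2)"
  define R where "R = (\<lambda>m. expect n s (\<lambda>y. (frob_norm r n (s - s_hat r n m y))\<^sup>2))"
  have \<delta>: "\<delta> > 0" using M by (simp add: \<delta>_def)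
  \<comment> \<open>A column summing to 1 forces \<open>{1..r}\<close> to be nonempty, so
    \<open>max_norm\<close> is bounded below by a nonnegative entry.\<close>
  have \<delta>1: "\<delta> \<le> 1"
  proof -
    have "1 \<in> {1..n}" using n by simp
    then have "(\<Sum>l=1..r. s l 1) = 1" using s unfolding distribution_matrices_def by blast
    then obtain l where l: "l \<in> {1..r}" by (metis all_not_in_conv sum.empty zero_neq_one)
    have "0 \<le> s l 1" using s by (simp add: distribution_matrices_def)
    then show ?thesis using entry_le_max_norm[OF s n l \<open>1 \<in> {1..n}\<close>] by (simp add: \<delta>_def)
  qed
  have K: "K > 0" using c0 \<delta> by (simp add: K_def)
  have "T / K \<le> R m" if m: "m \<in> dyadic_partitions N" for m
  proof -
    have D: "real (model_dim m) \<ge> 1" using dyadic_partitionsD(3,4)[OF m] by simp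
    have low: "\<delta> * model_dim m \<le> R m"
      using risk_lower_bound[OF s n m] by (simp add: \<delta>_def R_def)
    have "T \<le> 3 * R m + 2 * (c0 + 64) * model_dim m + 32"
      using risk_upper_bound[OF s n m _ pen sel] c0 by (simp add: T_def R_def)
    \<comment> \<open>The additive 32 is absorbed because the dimension is at least 1; then
      \<open>low\<close> trades dimension for risk at the price \<open>1 / \<delta>\<close>.\<close>
    also have "\<dots> \<le> 3 * R m + (2 * c0 + 160) * model_dim m"
      using D by (simp add: algebra_simps)
    also have "\<dots> \<le> 3 * (R m / \<delta>) + (2 * c0 + 160) * (R m / \<delta>)"
    proof (intro add_mono mult_left_mono)
      have "0 \<le> \<delta> * model_dim m" using \<delta> by simp
      then have "0 \<le> R m" using low by linarith
      then show "R m \<le> R m / \<delta>" using \<delta> \<delta>1 by (simp add: pos_le_divide_eq mult_left_le)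
      show "real (model_dim m) \<le> R m / \<delta>" using low \<delta> by (simp add: pos_le_divide_eq mult.commute)
    qed (use c0 in auto)
    also have "\<dots> = K * R m" by (simp add: K_def divide_inverse algebra_simps)
    finally show ?thesis using K by (simp add: pos_divide_le_eq mult.commute)
  qed
  \<comment> \<open>The one-block partition makes the index set nonempty, as
    \<open>cINF_greatest\<close> demands.\<close>
  then have "T / K \<le> (INF m\<in>dyadic_partitions N. R m)"
    using atLeastAtMost_in_dyadic_partitions by (intro cINF_greatest) auto
  then have "T \<le> K * (INF m\<in>dyadic_partitions N. R m)"
    using K by (simp add: pos_divide_le_eq mult.commute)
  then show "expect n s (\<lambda>y. (frob_norm r n (s - s_tilde r n m_hat y))\<^sup>2)
      \<le> (2 * c0 + 163) * inverse (1 - max_norm r n s) *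
        (INF m\<in>dyadic_partitions N. expect n s (\<lambda>y. (frob_norm r n (s - s_hat r n m y))\<^sup>2))"
    by (simp add: T_def K_def R_def \<delta>_def)
qed

end
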